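(* Let $n$ be a positive integer, let $\lambda_1,\dots,\lambda_n>0$, and let $(u_1,\dots,u_n)$, $u_i:\mathbb{R}^2\to\mathbb{C}$, be a solution of $$-\lambda_i\Delta u_i = u_i\Big(n-\sum_{j=1}^n|u_j|^2\Big)\quad\text{in }\mathbb{R}^2,\qquad i=1,\dots,n,$$ satisfying $$\sum_{j=1}^n\int_{\mathbb{R}^2}|\nabla u_j|^2\,dx<\infty.$$ Then either $(u_1,\dots,u_n)\equiv(0,\dots,0)$, or $(u_1,\dots,u_n)\equiv(c_1,\dots,c_n)$ for some constants $c_1,\dots,c_n\in\mathbb{C}$ with $|c_1|^2+\cdots+|c_n|^2=n$.
   Context: A solution means a tuple of smooth functions $u_i:\mathbb{R}^2\to\mathbb{C}$ satisfying the equations pointwise. *)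

theory Defs
  imports "HOL-Analysis.Analysis"
begin

text \<open>Functions of class \<open>C\<^sup>k\<close> on the whole space: \<open>f\<close> is \<open>C\<^sup>k\<^sup>+\<^sup>1\<close> iff it is (Frechet) differentiable
  everywhere and each of its directional derivatives is \<open>C\<^sup>k\<close>. All derivatives are over the reals,
  also for complex-valued functions.\<close>

primrec C_k :: "nat \<Rightarrow> ('a::euclidean_space \<Rightarrow> 'b::real_normed_vector) \<Rightarrow> bool" where
  "C_k 0 f \<longleftrightarrow> continuous_on UNIV f"
| "C_k (Suc k) f \<longleftrightarrow> (\<forall>x. f differentiable (at x)) \<and>
     (\<forall>v. C_k k (\<lambda>x. frechet_derivative f (at x) v))"

definition smooth :: "('a::euclidean_space \<Rightarrow> 'b::real_normed_vector) \<Rightarrow> bool" where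
  "smooth f \<longleftrightarrow> (\<forall>k. C_k k f)"

definition partial_deriv :: "'m \<Rightarrow> (real ^ 'm::finite \<Rightarrow> 'b::real_normed_vector) \<Rightarrow> real ^ 'm \<Rightarrow> 'b" where
  "partial_deriv k f x = frechet_derivative f (at x) (axis k 1)"

definition laplacian :: "(real ^ 'm::finite \<Rightarrow> 'b::real_normed_vector) \<Rightarrow> real ^ 'm \<Rightarrow> 'b" where
  "laplacian f x = (\<Sum>k\<in>UNIV. partial_deriv k (partial_deriv k f) x)"

definition gradient :: "(real ^ 'm::finite \<Rightarrow> 'b::real_normed_vector) \<Rightarrow> real ^ 'm \<Rightarrow> 'b ^ 'm" where
  "gradient f x = (\<chi> k. partial_deriv k f x)"

end

theory Submission
  imports Defs
begin

text \<open>
  A solution of \<open>- \<lambda>\<^sub>i \<Delta>u\<^sub>i = u\<^sub>i (n - |u|\<^sup>2)\<close> is a critical point of the energy with density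
  \<open>\<Sum>\<lambda>\<^sub>i |\<nabla>u\<^sub>i|\<^sup>2 / 2 + (n - |u|\<^sup>2)\<^sup>2 / 4\<close>. The proof looks at squares of side \<open>2S\<close> as \<open>S\<close> grows and plays
  three facts against each other. Throughout, \<open>e = \<Sum>\<lambda>\<^sub>i |\<nabla>u\<^sub>i|\<^sup>2\<close> is integrable by hypothesis.

  \<^item> The modulus is almost constant on average. The function \<open>w = \<Sum>\<lambda>\<^sub>i |u\<^sub>i|\<^sup>2\<close> satisfies
    \<open>\<Delta>w \<ge> 2 |u|\<^sup>2 (|u|\<^sup>2 - n)\<close>, and a Keller--Osserman barrier bounds it (\<open>modsq_bounded\<close>). Since \<open>e\<close> is
    integrable, the integral of \<open>|\<nabla>|u|\<^sup>2|\<close> over the square is \<open>o(S)\<close>, so by an \<open>L\<^sup>1\<close> Poincare inequality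
    \<open>|u|\<^sup>2\<close> is, up to a mean error \<open>o(1)\<close>, a constant \<open>c\<close> depending on \<open>S\<close>. Testing the equation
    with a cutoff gives \<open>c (n - c) = o(1)\<close> (\<open>modsq_almost_constant\<close>). Hence, along a sequence of
    squares, \<open>c\<close> tends to \<open>n\<close> or to \<open>0\<close>, and the potential \<open>(n - |u|\<^sup>2)\<^sup>2 / 4\<close> tends in mean to
    \<open>\<kappa> = 0\<close> or to \<open>\<kappa> = n\<^sup>2 / 4\<close> (\<open>potential_dichotomy\<close>).

  \<^item> A Pohozaev identity. The stress tensor \<open>T\<close> is divergence free, also after the constant \<open>\<kappa>\<close>
    has been subtracted from the potential, and in two dimensions its gradient part is trace free.
    Contract it with the field \<open>f(x) x\<close>, where \<open>f = a\<^sup>2 / (a\<^sup>2 + |x|\<^sup>2)\<close>. The divergence of this field is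
    exactly \<open>2 f\<^sup>2\<close>, which is positive and tends to \<open>2\<close> as \<open>a\<close> grows; the gradient part only meets
    \<open>f\<^sup>2 |x|\<^sup>2 / a\<^sup>2\<close>, which is bounded by \<open>1\<close> and tends to \<open>0\<close>; and the error due to cutting off at scale
    \<open>S\<close> is controlled by the means of \<open>e\<close> and \<open>|V|\<close>, where \<open>V = (n - |u|\<^sup>2)\<^sup>2 / 4 - \<kappa>\<close>. With the right \<open>\<kappa>\<close>, the
    integral of \<open>V f\<^sup>2\<close> is therefore arbitrarily small (\<open>pohozaev\<close>, \<open>potential_integral_small\<close>).

  \<^item> Conclusion. If \<open>\<kappa> = 0\<close> then \<open>V \<ge> 0\<close>, so \<open>|u|\<^sup>2 = n\<close> identically; then every \<open>u\<^sub>i\<close> is harmonic and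
    \<open>0 = \<Delta>|u|\<^sup>2 = 2 \<Sum>|\<nabla>u\<^sub>i|\<^sup>2\<close>. If \<open>\<kappa> = n\<^sup>2 / 4\<close> then \<open>4V = |u|\<^sup>4 - 2n |u|\<^sup>2\<close>, while testing the equation
    with \<open>f\<^sup>2 u\<close> gives, in the limit, that the integral of \<open>e - n |u|\<^sup>2 + |u|\<^sup>4\<close> vanishes. Subtracting the two,
    the integral of \<open>e + n |u|\<^sup>2\<close> vanishes, so \<open>u = 0\<close> (\<open>zero_modulus\<close>).

  All integrals are taken over squares, because there the divergence theorem is Fubini's theorem
  together with the fundamental theorem of calculus. The argument is carried out for the real system
  satisfied by the real and imaginary parts, regarded as functions of a pair of reals; the last
  section translates.
\<close>

section \<open>Calculus on squares\<close>

definition Q :: "real \<Rightarrow> (real \<times> real) set"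
  where "Q S = cbox (-S, -S) (S, S)"

lemma mem_Q: "z \<in> Q S \<longleftrightarrow> \<bar>fst z\<bar> \<le> S \<and> \<bar>snd z\<bar> \<le> S"
  by (cases z) (auto simp: Q_def cbox_Pair_eq)

lemma integrable_Q:
  fixes F :: "real \<times> real \<Rightarrow> real"
  shows "continuous_on UNIV F \<Longrightarrow> F integrable_on Q S"
  unfolding Q_def by (rule integrable_continuous) (rule continuous_on_subset, auto)

lemma integral_Q_mono:
  fixes F G :: "real \<times> real \<Rightarrow> real"
  assumes "continuous_on UNIV F" "continuous_on UNIV G" "\<And>z. z \<in> Q S \<Longrightarrow> F z \<le> G z"
  shows "integral (Q S) F \<le> integral (Q S) G"
  using assms by (intro integral_le integrable_Q)

lemma integral_Q_subset:
  fixes F :: "real \<times> real \<Rightarrow> real"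
  assumes "continuous_on UNIV F" "\<And>z. z \<in> Q S \<Longrightarrow> F z \<ge> 0" "L \<le> S"
  shows "integral (Q L) F \<le> integral (Q S) F"
  using assms by (intro integral_subset_le integrable_Q) (auto simp: mem_Q)

lemma integral_Q_const:
  assumes "S > 0"
  shows "integral (Q S) (\<lambda>z. c) = 4 * S\<^sup>2 * c"
  using assms unfolding Q_def
  by (simp add: content_Pair power2_eq_square)

lemma integral_Q_iterated:
  fixes F :: "real \<times> real \<Rightarrow> real"
  assumes "continuous_on UNIV F"
  shows "integral (Q S) F = integral {-S..S} (\<lambda>x. integral {-S..S} (\<lambda>y. F (x, y)))"
    and "integral (Q S) F = integral {-S..S} (\<lambda>y. integral {-S..S} (\<lambda>x. F (x, y)))"
proof -
  have c: "continuous_on A F" for A using assms continuous_on_subset by blast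
  show 1: "integral (Q S) F = integral {-S..S} (\<lambda>x. integral {-S..S} (\<lambda>y. F (x, y)))"
    unfolding Q_def using integral_prod_continuous[OF c, of "-S" "-S" S S] by simp
  show "integral (Q S) F = integral {-S..S} (\<lambda>y. integral {-S..S} (\<lambda>x. F (x, y)))"
    unfolding 1 using integral_swap_continuous[of "-S" "-S" S S "\<lambda>x y. F (x,y)"] c by simp
qed

lemma continuous_on_slice:
  fixes F :: "real \<times> real \<Rightarrow> real"
  assumes "continuous_on UNIV F"
  shows "continuous_on A (\<lambda>t. F (t, y))" "continuous_on A (\<lambda>t. F (x, t))"
  by (auto intro!: continuous_intros continuous_on_compose2[OF assms])

text \<open>Integrate each partial derivative first along its own variable: the inner integral is a
  difference of boundary values, hence zero.\<close>
lemma box_divergence: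
  fixes A B a b :: "real \<times> real \<Rightarrow> real"
  assumes A: "\<And>x y. ((\<lambda>t. A (t, y)) has_real_derivative a (x, y)) (at x)"
    and B: "\<And>x y. ((\<lambda>t. B (x, t)) has_real_derivative b (x, y)) (at y)"
    and ca: "continuous_on UNIV a" and cb: "continuous_on UNIV b"
    and "S > 0"
    and A0: "\<And>y. A (S, y) = 0" "\<And>y. A (-S, y) = 0"
    and B0: "\<And>x. B (x, S) = 0" "\<And>x. B (x, -S) = 0"
  shows "integral (Q S) (\<lambda>z. a z + b z) = 0"
proof -
  have "((\<lambda>x. a (x, y)) has_integral 0) {-S..S}" for y
    using fundamental_theorem_of_calculus[of "-S" S "\<lambda>t. A (t, y)" "\<lambda>x. a (x, y)"] A \<open>S > 0\<close>
    by (auto simp: A0 has_real_derivative_iff_has_vector_derivative has_vector_derivative_at_within)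
  from integral_unique[OF this] have a: "integral (Q S) a = 0"
    unfolding integral_Q_iterated(2)[OF ca] by simp
  have "((\<lambda>y. b (x, y)) has_integral 0) {-S..S}" for x
    using fundamental_theorem_of_calculus[of "-S" S "\<lambda>t. B (x, t)" "\<lambda>y. b (x, y)"] B \<open>S > 0\<close>
    by (auto simp: B0 has_real_derivative_iff_has_vector_derivative has_vector_derivative_at_within)
  from integral_unique[OF this] have b: "integral (Q S) b = 0"
    unfolding integral_Q_iterated(1)[OF cb] by simp
  show ?thesis
    using a b by (simp add: integral_add integrable_Q ca cb)
qed

text \<open>The form in which every identity below is obtained: test a vector field \<open>(A, B)\<close> with a scalar
  weight that vanishes on the boundary of the square.\<close>
lemma weighted_divergence:
  fixes A B Ax By g gx gy :: "real \<times> real \<Rightarrow> real"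
  assumes A: "\<And>x y. ((\<lambda>t. A (t, y)) has_real_derivative Ax (x, y)) (at x)"
    and B: "\<And>x y. ((\<lambda>t. B (x, t)) has_real_derivative By (x, y)) (at y)"
    and gx: "\<And>x y. ((\<lambda>t. g (t, y)) has_real_derivative gx (x, y)) (at x)"
    and gy: "\<And>x y. ((\<lambda>t. g (x, t)) has_real_derivative gy (x, y)) (at y)"
    and cont: "continuous_on UNIV A" "continuous_on UNIV B" "continuous_on UNIV Ax"
      "continuous_on UNIV By" "continuous_on UNIV g" "continuous_on UNIV gx" "continuous_on UNIV gy"
    and "S > 0"
    and g0: "\<And>y. g (S, y) = 0" "\<And>y. g (-S, y) = 0" "\<And>x. g (x, S) = 0" "\<And>x. g (x, -S) = 0"
  shows "integral (Q S) (\<lambda>z. g z * (Ax z + By z) + (gx z * A z + gy z * B z)) = 0"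
proof -
  have "integral (Q S) (\<lambda>z. (gx z * A z + Ax z * g z) + (gy z * B z + By z * g z)) = 0"
    by (rule box_divergence[where A="\<lambda>z. g z * A z" and B="\<lambda>z. g z * B z"])
      (use \<open>S > 0\<close> in \<open>auto intro!: DERIV_mult A B gx gy continuous_intros cont simp: g0\<close>)
  then show ?thesis by (simp add: algebra_simps)
qed

lemma abs_diff_le_integral_abs_deriv:
  fixes h h' :: "real \<Rightarrow> real"
  assumes d: "\<And>t. (h has_real_derivative h' t) (at t)" and c: "continuous_on UNIV h'"
    and "\<bar>x\<bar> \<le> S" "\<bar>y\<bar> \<le> S"
  shows "\<bar>h x - h y\<bar> \<le> integral {-S..S} (\<lambda>t. \<bar>h' t\<bar>)"
proof -
  have ci: "(\<lambda>t. \<bar>h' t\<bar>) integrable_on {a..b}" "h' integrable_on {a..b}" for a b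
    using continuous_on_subset[OF c subset_UNIV]
    by (auto intro!: integrable_continuous_interval continuous_on_rabs)
  have *: "\<bar>h b - h a\<bar> \<le> integral {-S..S} (\<lambda>t. \<bar>h' t\<bar>)" if "a \<le> b" "-S \<le> a" "b \<le> S" for a b
  proof -
    have "(h' has_integral (h b - h a)) {a..b}"
      using fundamental_theorem_of_calculus[of a b h h'] d that
      by (auto simp: has_real_derivative_iff_has_vector_derivative has_vector_derivative_at_within)
    then have "\<bar>h b - h a\<bar> = norm (integral {a..b} h')" by (simp add: integral_unique)
    also have "\<dots> \<le> integral {a..b} (\<lambda>t. \<bar>h' t\<bar>)"
      by (rule integral_norm_bound_integral) (use ci in auto)
    also have "\<dots> \<le> integral {-S..S} (\<lambda>t. \<bar>h' t\<bar>)"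
      by (rule integral_subset_le) (use ci that in auto)
    finally show ?thesis .
  qed
  show ?thesis
    using *[of x y] *[of y x] assms(3,4) by (cases "x \<le> y") (auto simp: abs_minus_commute)
qed

text \<open>Join \<open>(x, y)\<close> to \<open>(x0, 0)\<close> by a horizontal and then a vertical segment. The first leg costs
  the integral of \<open>|Fx|\<close> over a full horizontal line, which Fubini averages; the second runs inside
  the single line \<open>x = x0\<close>, which can be chosen with a below-average integral of \<open>|Fy|\<close>.\<close>
lemma square_poincare:
  fixes F Fx Fy :: "real \<times> real \<Rightarrow> real"
  assumes Fx: "\<And>x y. ((\<lambda>t. F (t, y)) has_real_derivative Fx (x, y)) (at x)"
    and Fy: "\<And>x y. ((\<lambda>t. F (x, t)) has_real_derivative Fy (x, y)) (at y)"
    and c: "continuous_on UNIV F" "continuous_on UNIV Fx" "continuous_on UNIV Fy" and "S > 0"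
  shows "\<exists>z0. integral (Q S) (\<lambda>z. \<bar>F z - F z0\<bar>) \<le> 2 * S * integral (Q S) (\<lambda>z. \<bar>Fx z\<bar> + \<bar>Fy z\<bar>)"
proof -
  define J where "J x = integral {-S..S} (\<lambda>t. \<bar>Fy (x, t)\<bar>)" for x
  define K where "K y = integral {-S..S} (\<lambda>t. \<bar>Fx (t, y)\<bar>)" for y
  have ca: "continuous_on UNIV (\<lambda>z. \<bar>Fx z\<bar>)" "continuous_on UNIV (\<lambda>z. \<bar>Fy z\<bar>)"
    using c by (auto intro!: continuous_intros)
  have cJ: "continuous_on UNIV J"
    unfolding J_def box_real[symmetric]
    by (rule integral_continuous_on_param)
      (auto simp: case_prod_unfold intro!: continuous_intros continuous_on_compose2[OF c(3)])
  have cK: "continuous_on UNIV K"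
    unfolding K_def box_real[symmetric]
    by (rule integral_continuous_on_param)
      (auto simp: case_prod_unfold intro!: continuous_intros continuous_on_compose2[OF c(2)])
  obtain x0 where x0: "x0 \<in> {-S..S}" "\<And>x. x \<in> {-S..S} \<Longrightarrow> J x0 \<le> J x"
    using continuous_attains_inf[of "{-S..S}" J] \<open>S > 0\<close> continuous_on_subset[OF cJ subset_UNIV]
    by (auto simp: Bex_def Ball_def)
  have "integral {-S..S} (\<lambda>x. J x0) \<le> integral {-S..S} J"
    using x0 continuous_on_subset[OF cJ subset_UNIV]
    by (intro integral_le integrable_continuous_interval) auto
  then have J: "2 * S * J x0 \<le> integral (Q S) (\<lambda>z. \<bar>Fy z\<bar>)"
    using \<open>S > 0\<close> by (simp add: integral_Q_iterated(1)[OF ca(2)] J_def[abs_def])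
  have cKs: "continuous_on UNIV (\<lambda>z::real\<times>real. K (snd z))"
    by (auto intro!: continuous_intros continuous_on_compose2[OF cK])
  have K: "integral (Q S) (\<lambda>z. K (snd z)) = 2 * S * integral (Q S) (\<lambda>z. \<bar>Fx z\<bar>)"
    unfolding integral_Q_iterated(2)[OF ca(1)] integral_Q_iterated(1)[OF cKs]
    using \<open>S > 0\<close> by (simp add: K_def[abs_def])
  have "integral (Q S) (\<lambda>z. \<bar>F z - F (x0, 0)\<bar>) \<le> integral (Q S) (\<lambda>z. K (snd z) + J x0)"
  proof (rule integral_Q_mono)
    fix z assume "z \<in> Q S"
    then obtain x y where z: "z = (x, y)" "\<bar>x\<bar> \<le> S" "\<bar>y\<bar> \<le> S" by (cases z) (auto simp: mem_Q)
    have "\<bar>F (x, y) - F (x0, y)\<bar> \<le> K y"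
      unfolding K_def using x0(1) z
      by (intro abs_diff_le_integral_abs_deriv[of "\<lambda>t. F (t, y)"] Fx continuous_on_slice c) auto
    moreover have "\<bar>F (x0, y) - F (x0, 0)\<bar> \<le> J x0"
      unfolding J_def using x0(1) z
      by (intro abs_diff_le_integral_abs_deriv[of "\<lambda>t. F (x0, t)"] Fy continuous_on_slice c) auto
    ultimately show "\<bar>F z - F (x0, 0)\<bar> \<le> K (snd z) + J x0" using z by auto
  qed (auto intro!: continuous_intros cKs c)
  also have "\<dots> = integral (Q S) (\<lambda>z. K (snd z)) + 4 * S\<^sup>2 * J x0"
    using \<open>S > 0\<close> by (subst integral_add) (auto intro!: integrable_Q cKs simp: integral_Q_const)
  also have "\<dots> \<le> 2 * S * integral (Q S) (\<lambda>z. \<bar>Fx z\<bar>) + 2 * S * integral (Q S) (\<lambda>z. \<bar>Fy z\<bar>)"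
    using K mult_left_mono[OF J, of "2 * S"] \<open>S > 0\<close> by (simp add: power2_eq_square)
  also have "\<dots> = 2 * S * integral (Q S) (\<lambda>z. \<bar>Fx z\<bar> + \<bar>Fy z\<bar>)"
    by (subst integral_add) (auto intro!: integrable_Q ca simp: algebra_simps)
  finally show ?thesis by blast
qed

text \<open>Over any rectangle both mixed derivatives integrate to the same alternating sum of the values
  of \<open>F\<close> at the corners, so their continuous difference has zero integral over every rectangle.\<close>
lemma partials_commute:
  fixes F Fx Fy Fxy Fyx :: "real \<times> real \<Rightarrow> real"
  assumes Fx: "\<And>x y. ((\<lambda>t. F (t, y)) has_real_derivative Fx (x, y)) (at x)"
    and Fy: "\<And>x y. ((\<lambda>t. F (x, t)) has_real_derivative Fy (x, y)) (at y)"
    and Fxy: "\<And>x y. ((\<lambda>t. Fx (x, t)) has_real_derivative Fxy (x, y)) (at y)"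
    and Fyx: "\<And>x y. ((\<lambda>t. Fy (t, y)) has_real_derivative Fyx (x, y)) (at x)"
    and c: "continuous_on UNIV Fx" "continuous_on UNIV Fy" "continuous_on UNIV Fxy" "continuous_on UNIV Fyx"
  shows "Fxy = Fyx"
proof -
  have fund: "((\<lambda>t. h' t) has_integral (h b - h a)) {a..b}"
    if "\<And>t. (h has_real_derivative h' t) (at t)" "a \<le> b" for h h' :: "real \<Rightarrow> real" and a b
    using fundamental_theorem_of_calculus[of a b h h'] that
    by (auto simp: has_real_derivative_iff_has_vector_derivative has_vector_derivative_at_within)
  have int: "h integrable_on {a..b}" if "continuous_on UNIV h" for h :: "real \<Rightarrow> real" and a b
    using that by (intro integrable_continuous_interval) (auto intro: continuous_on_subset)
  have cs: "continuous_on A F" if "continuous_on UNIV F" for A and F :: "real \<times> real \<Rightarrow> real"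
    using that continuous_on_subset by blast
  have zero: "integral (cbox (a, p) (b, q)) (\<lambda>z. Fxy z - Fyx z) = 0" if "a \<le> b" "p \<le> q" for a b p q
  proof -
    have "integral (cbox (a, p) (b, q)) Fxy = integral {a..b} (\<lambda>x. Fx (x, q) - Fx (x, p))"
      using integral_unique[OF fund[OF Fxy \<open>p \<le> q\<close>]]
      by (simp add: integral_prod_continuous[OF cs[OF c(3)]])
    also have "\<dots> = (F (b, q) - F (a, q)) - (F (b, p) - F (a, p))"
      by (rule integral_unique, rule has_integral_diff) (intro fund Fx that)+
    finally have 1: "integral (cbox (a, p) (b, q)) Fxy = (F (b, q) - F (a, q)) - (F (b, p) - F (a, p))" .
    have "integral (cbox (a, p) (b, q)) Fyx
        = integral {p..q} (\<lambda>y. integral {a..b} (\<lambda>x. Fyx (x, y)))"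
      using integral_swap_continuous[of a p b q "\<lambda>x y. Fyx (x, y)"] cs[OF c(4)]
      by (simp add: integral_prod_continuous[OF cs[OF c(4)]])
    also have "\<dots> = integral {p..q} (\<lambda>y. Fy (b, y) - Fy (a, y))"
      using integral_unique[OF fund[OF Fyx \<open>a \<le> b\<close>]] by simp
    also have "\<dots> = (F (b, q) - F (b, p)) - (F (a, q) - F (a, p))"
      by (rule integral_unique, rule has_integral_diff) (intro fund Fy that)+
    finally have 2: "integral (cbox (a, p) (b, q)) Fyx = (F (b, q) - F (b, p)) - (F (a, q) - F (a, p))" .
    show ?thesis
      using 1 2 by (subst integral_diff) (auto intro!: integrable_continuous cs c)
  qed
  have no: False if ch: "continuous_on UNIV h" and h0: "h z0 > 0"
    and hz: "\<And>a b p q. a \<le> b \<Longrightarrow> p \<le> q \<Longrightarrow> integral (cbox (a, p) (b, q)) h = 0"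
    for h :: "real \<times> real \<Rightarrow> real" and z0
  proof -
    have "open {z. h z > 0}" using ch by (intro open_Collect_less) auto
    then obtain a b where ab: "z0 \<in> box a b" "cbox a b \<subseteq> {z. h z > 0}"
      "\<forall>i\<in>Basis. a \<bullet> i < b \<bullet> i"
      using open_contains_cbox[of "{z. h z > 0}" z0] h0 by (metis mem_Collect_eq)
    obtain a1 a2 b1 b2 where e: "a = (a1, a2)" "b = (b1, b2)" by (metis surj_pair)
    have "box a b \<noteq> {}" using ab by auto
    have "a1 < b1" "a2 < b2" using ab(3) by (auto simp: e Basis_prod_def)
    then have "integral (cbox a b) h = 0" using hz e by simp
    moreover have "h x \<ge> 0" if "x \<in> cbox a b" for x
      using ab(2) that by (blast intro: less_imp_le)
    ultimately have "\<forall>x\<in>cbox a b. h x = 0"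
      using integral_cbox_eq_0_iff[OF continuous_on_subset[OF ch subset_UNIV] \<open>box a b \<noteq> {}\<close>] by blast
    then have "h z0 = 0" using ab(1) box_subset_cbox by blast
    with h0 show False by simp
  qed
  have le: "Fxy z \<le> Fyx z" for z
    using no[of "\<lambda>z. Fxy z - Fyx z" z] zero continuous_on_diff[OF c(3,4)] by fastforce
  have "integral (cbox (a, p) (b, q)) (\<lambda>z. Fyx z - Fxy z) = 0" if "a \<le> b" "p \<le> q" for a b p q
    using zero[OF that] integral_neg[of "cbox (a, p) (b, q)" "\<lambda>z. Fxy z - Fyx z"] by simp
  then have "Fyx z \<le> Fxy z" for z
    using no[of "\<lambda>z. Fyx z - Fxy z" z] continuous_on_diff[OF c(4,3)] by fastforce
  with le show ?thesis by (intro ext antisym)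
qed

section \<open>The Keller--Osserman bound\<close>

lemma second_deriv_nonpos_at_local_max:
  fixes h h' :: "real \<Rightarrow> real"
  assumes "r > 0" and d: "\<And>t. \<bar>t - x\<bar> < r \<Longrightarrow> (h has_real_derivative h' t) (at t)"
    and dd: "(h' has_real_derivative D) (at x)"
    and mx: "\<And>t. \<bar>t - x\<bar> < r \<Longrightarrow> h t \<le> h x"
  shows "D \<le> 0"
proof (rule ccontr)
  assume "\<not> D \<le> 0"
  have h0: "h' x = 0"
    by (rule DERIV_local_max[OF d \<open>r > 0\<close>]) (use mx \<open>r > 0\<close> in \<open>auto simp: abs_minus_commute\<close>)
  obtain \<delta> where \<delta>: "\<delta> > 0" "\<And>t. t > 0 \<Longrightarrow> t < \<delta> \<Longrightarrow> h' x < h' (x + t)"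
    using DERIV_pos_inc_right[OF dd] \<open>\<not> D \<le> 0\<close> by force
  define t where "t = min \<delta> r / 2"
  have t: "0 < t" "t < \<delta>" "t < r" using \<open>r > 0\<close> \<open>\<delta> > 0\<close> by (auto simp: t_def min_def)
  obtain c where c: "x < c" "c < x + t" "h (x + t) - h x = (x + t - x) * h' c"
    using MVT2[of x "x + t" h h'] d t by force
  have "h' c > 0" using \<delta>(2)[of "c - x"] c t h0 by auto
  then have "h (x + t) > h x" using c(3) t by (smt (verit) mult_pos_pos)
  with mx[of "x + t"] t show False by auto
qed

text \<open>A one-dimensional barrier: it blows up at \<open>\<plusminus>R\<close>, is a supersolution of \<open>g'' = (24 / M) g\<^sup>2\<close>, and its
  value \<open>M / R\<^sup>2\<close> at the centre tends to \<open>0\<close> as \<open>R\<close> grows.\<close>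
lemma blow_up_profile:
  fixes M R t :: real
  assumes "\<bar>t\<bar> < R" "M > 0"
  defines "g \<equiv> \<lambda>t. M * R\<^sup>2 / (R\<^sup>2 - t\<^sup>2)\<^sup>2"
    and "g' \<equiv> \<lambda>t. 4 * M * R\<^sup>2 * t / (R\<^sup>2 - t\<^sup>2) ^ 3"
    and "g'' \<equiv> \<lambda>t. 4 * M * R\<^sup>2 * (R\<^sup>2 + 5 * t\<^sup>2) / (R\<^sup>2 - t\<^sup>2) ^ 4"
  shows "(g has_real_derivative g' t) (at t)"
    and "(g' has_real_derivative g'' t) (at t)"
    and "g'' t \<le> 24 / M * (g t)\<^sup>2"
proof -
  have "t\<^sup>2 < R\<^sup>2" using power_strict_mono[OF assms(1), of 2] by simp
  then have q: "R\<^sup>2 - t\<^sup>2 > 0" by simp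
  show "(g has_real_derivative g' t) (at t)"
    unfolding g_def g'_def using q
    by (auto intro!: derivative_eq_intros) (simp add: divide_simps, simp add: algebra_simps power_numeral_reduce)
  show "(g' has_real_derivative g'' t) (at t)"
    unfolding g'_def g''_def using q
    by (auto intro!: derivative_eq_intros) (simp add: divide_simps, simp add: algebra_simps power_numeral_reduce)
  have "g'' t \<le> 4 * M * R\<^sup>2 * (6 * R\<^sup>2) / (R\<^sup>2 - t\<^sup>2) ^ 4"
    unfolding g''_def using q \<open>M > 0\<close> by (intro divide_right_mono mult_left_mono) auto
  also have "\<dots> = 24 / M * (g t)\<^sup>2"
    unfolding g_def using q \<open>M > 0\<close> by (simp add: field_simps power2_eq_square power4_eq_xxxx)
  finally show "g'' t \<le> 24 / M * (g t)\<^sup>2" .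
qed

text \<open>A subsolution of \<open>\<Delta>w = \<alpha> w\<^sup>2\<close> on the whole plane cannot be positive. Compare it near \<open>z0\<close> with
  the barrier \<open>g (x - x0) + g (y - y0)\<close>: at a positive maximum of the difference,
  \<open>\<Delta>w \<le> \<alpha> (g (x - x0)\<^sup>2 + g (y - y0)\<^sup>2) \<le> \<alpha> (g (x - x0) + g (y - y0))\<^sup>2 < \<alpha> w\<^sup>2\<close>, a contradiction. So \<open>w z0\<close> is at
  most \<open>2M / R\<^sup>2\<close> for every \<open>R\<close>.\<close>
lemma keller_osserman:
  fixes w wx wy wxx wyy :: "real \<times> real \<Rightarrow> real"
  assumes wx: "\<And>x y. ((\<lambda>t. w (t, y)) has_real_derivative wx (x, y)) (at x)"
    and wy: "\<And>x y. ((\<lambda>t. w (x, t)) has_real_derivative wy (x, y)) (at y)"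
    and wxx: "\<And>x y. ((\<lambda>t. wx (t, y)) has_real_derivative wxx (x, y)) (at x)"
    and wyy: "\<And>x y. ((\<lambda>t. wy (x, t)) has_real_derivative wyy (x, y)) (at y)"
    and cw: "continuous_on UNIV w" and "\<alpha> > 0"
    and ineq: "\<And>z. w z > 0 \<Longrightarrow> wxx z + wyy z \<ge> \<alpha> * (w z)\<^sup>2"
  shows "w z0 \<le> 0"
proof (rule ccontr)
  assume "\<not> w z0 \<le> 0"
  then have pos: "w z0 > 0" by simp
  obtain x0 y0 where z0: "z0 = (x0, y0)" by (cases z0)
  define M where "M = 24 / \<alpha>"
  have M: "M > 0" "24 / M = \<alpha>" using \<open>\<alpha> > 0\<close> by (auto simp: M_def)
  \<comment> \<open>large enough for the barrier to lie below \<open>w\<close> at the centre\<close>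
  define R where "R = sqrt (2 * M / w z0) + 1"
  have "R > 0" using M pos by (simp add: R_def add_nonneg_pos)
  have "2 * M / w z0 = (sqrt (2 * M / w z0))\<^sup>2" using M pos by simp
  also have "\<dots> < R\<^sup>2" unfolding R_def using M pos by (intro power_strict_mono) auto
  finally have R: "2 * M / R\<^sup>2 < w z0" using pos \<open>R > 0\<close> by (simp add: field_simps)
  define g where "g t = M * R\<^sup>2 / (R\<^sup>2 - t\<^sup>2)\<^sup>2" for t
  define g' where "g' t = 4 * M * R\<^sup>2 * t / (R\<^sup>2 - t\<^sup>2) ^ 3" for t
  define g'' where "g'' t = 4 * M * R\<^sup>2 * (R\<^sup>2 + 5 * t\<^sup>2) / (R\<^sup>2 - t\<^sup>2) ^ 4" for t
  have g: "(g has_real_derivative g' t) (at t)" "(g' has_real_derivative g'' t) (at t)"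
    "g'' t \<le> \<alpha> * (g t)\<^sup>2" if "\<bar>t\<bar> < R" for t
    using blow_up_profile[OF that M(1)] M(2) unfolding g_def g'_def g''_def by metis+
  have g_shift: "((\<lambda>t. g (t - c)) has_real_derivative g' (t - c)) (at t)"
    "((\<lambda>t. g' (t - c)) has_real_derivative g'' (t - c)) (at t)" if "\<bar>t - c\<bar> < R" for t c
  proof -
    have "((\<lambda>t. t - c) has_real_derivative 1) (at t)" by (auto intro!: derivative_eq_intros)
    then show "((\<lambda>t. g (t - c)) has_real_derivative g' (t - c)) (at t)"
      "((\<lambda>t. g' (t - c)) has_real_derivative g'' (t - c)) (at t)"
      using DERIV_chain2[where g="\<lambda>t. t - c" and x=t and Db=1 and f=g, OF g(1)[OF that]]
        DERIV_chain2[where g="\<lambda>t. t - c" and x=t and Db=1 and f=g', OF g(2)[OF that]] by simp_all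
  qed
  have g_nonneg: "g t \<ge> 0" for t using M by (simp add: g_def)
  have "bounded (w ` cbox (x0 - R, y0 - R) (x0 + R, y0 + R))"
    by (intro compact_imp_bounded compact_continuous_image compact_cbox
        continuous_on_subset[OF cw subset_UNIV])
  then obtain B where B: "\<And>z. z \<in> cbox (x0 - R, y0 - R) (x0 + R, y0 + R) \<Longrightarrow> \<bar>w z\<bar> \<le> B"
    unfolding bounded_iff by auto
  have "B \<ge> 0" using B[of z0] \<open>R > 0\<close> by (fastforce simp: z0 cbox_Pair_eq dest: order_trans[OF abs_ge_zero])
  \<comment> \<open>The barrier is infinite on the boundary of the square of radius \<open>R\<close>. Shrinking \<open>R\<^sup>2\<close> by \<open>\<eta>\<close>
     gives a compact square on which it is continuous and near whose boundary it exceeds the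
     bound \<open>B\<close> of \<open>w\<close>, so that the maximum of the difference is attained in the interior.\<close>
  define \<eta> where "\<eta> = min (R\<^sup>2 / 2) (sqrt (M * R\<^sup>2 / (B + 1)))"
  have \<eta>: "\<eta> > 0" using \<open>R > 0\<close> M(1) \<open>B \<ge> 0\<close> by (simp add: \<eta>_def)
  have "\<eta> \<le> R\<^sup>2 / 2" by (simp add: \<eta>_def)
  also have "\<dots> < R\<^sup>2" using \<open>R > 0\<close> by simp
  finally have "\<eta> < R\<^sup>2" .
  have "\<eta>\<^sup>2 \<le> (sqrt (M * R\<^sup>2 / (B + 1)))\<^sup>2" using \<eta> by (intro power_mono) (auto simp: \<eta>_def)
  then have \<eta>2: "(B + 1) * \<eta>\<^sup>2 \<le> M * R\<^sup>2" using M \<open>B \<ge> 0\<close> by (simp add: field_simps)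
  define r where "r = sqrt (R\<^sup>2 - \<eta>)"
  have r: "r > 0" "r < R" "r\<^sup>2 = R\<^sup>2 - \<eta>"
    using \<eta> \<open>\<eta> < R\<^sup>2\<close> \<open>R > 0\<close> by (auto simp: r_def intro: real_less_lsqrt)
  have g_large: "g t > B" if "r \<le> \<bar>t\<bar>" "\<bar>t\<bar> < R" for t
  proof -
    have "r\<^sup>2 \<le> t\<^sup>2" using power_mono[OF that(1), of 2] r by simp
    moreover have "t\<^sup>2 < R\<^sup>2" using power_strict_mono[OF that(2), of 2] by simp
    ultimately have q: "0 < R\<^sup>2 - t\<^sup>2" "R\<^sup>2 - t\<^sup>2 \<le> \<eta>" using r by auto
    have "(B + 1) * (R\<^sup>2 - t\<^sup>2)\<^sup>2 \<le> (B + 1) * \<eta>\<^sup>2"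
      using q \<open>B \<ge> 0\<close> by (intro mult_left_mono power_mono) auto
    then have "B + 1 \<le> g t" using \<eta>2 q unfolding g_def by (simp add: field_simps)
    then show ?thesis by simp
  qed
  define C where "C = cbox (x0 - r, y0 - r) (x0 + r, y0 + r)"
  have memC: "(x, y) \<in> C \<longleftrightarrow> \<bar>x - x0\<bar> \<le> r \<and> \<bar>y - y0\<bar> \<le> r" for x y
    by (auto simp: C_def cbox_Pair_eq)
  define h where "h z = w z - g (fst z - x0) - g (snd z - y0)" for z
  have cg: "continuous_on {-r..r} g"
    using r by (intro DERIV_continuous_on[OF DERIV_subset[OF g(1)]]) auto
  have "continuous_on C h"
    unfolding h_def
    by (intro continuous_intros continuous_on_subset[OF cw] continuous_on_compose2[OF cg])
      (auto simp: memC abs_le_iff)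
  moreover have "(x0, y0) \<in> C" using r by (simp add: memC)
  moreover have "compact C" by (simp add: C_def)
  ultimately obtain zm where zm: "zm \<in> C" "\<And>z. z \<in> C \<Longrightarrow> h z \<le> h zm"
    using continuous_attains_sup[of C h] by fast
  obtain x y where xy: "zm = (x, y)" by (cases zm)
  have g0: "g 0 = M / R\<^sup>2" using \<open>R > 0\<close> by (simp add: g_def power2_eq_square)
  have "0 < h z0" using R g0 by (simp add: h_def z0)
  also have "h z0 \<le> h zm" using zm r by (simp add: z0 memC)
  finally have h: "w (x, y) > g (x - x0) + g (y - y0)" by (simp add: h_def xy)
  have "(x, y) \<in> cbox (x0 - R, y0 - R) (x0 + R, y0 + R)"
    using zm(1) r by (auto simp: xy memC cbox_Pair_eq abs_le_iff)
  from B[OF this] have wB: "w (x, y) \<le> B" by simp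
  have x: "\<bar>x - x0\<bar> < r" and y: "\<bar>y - y0\<bar> < r"
    using g_large[of "x - x0"] g_large[of "y - y0"] g_nonneg[of "x - x0"] g_nonneg[of "y - y0"]
      h wB zm(1) r unfolding xy memC by linarith+
  have "wxx (x, y) - g'' (x - x0) \<le> 0"
  proof (rule second_deriv_nonpos_at_local_max[where r="r - \<bar>x - x0\<bar>" and x=x
        and h="\<lambda>t. w (t, y) - g (t - x0)" and h'="\<lambda>t. wx (t, y) - g' (t - x0)"])
    show "r - \<bar>x - x0\<bar> > 0" using x by simp
    show "((\<lambda>t. w (t, y) - g (t - x0)) has_real_derivative wx (t, y) - g' (t - x0)) (at t)"
      if "\<bar>t - x\<bar> < r - \<bar>x - x0\<bar>" for t
    proof -
      have "\<bar>t - x0\<bar> < R" using that r by linarith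
      then show ?thesis by (intro DERIV_diff wx g_shift)
    qed
    have "\<bar>x - x0\<bar> < R" using x r by linarith
    then show "((\<lambda>t. wx (t, y) - g' (t - x0)) has_real_derivative wxx (x, y) - g'' (x - x0)) (at x)"
      by (intro DERIV_diff wxx g_shift)
    show "w (t, y) - g (t - x0) \<le> w (x, y) - g (x - x0)" if "\<bar>t - x\<bar> < r - \<bar>x - x0\<bar>" for t
    proof -
      have "(t, y) \<in> C" using that y unfolding memC by linarith
      from zm(2)[OF this] show ?thesis by (simp add: h_def xy)
    qed
  qed
  moreover have "wyy (x, y) - g'' (y - y0) \<le> 0"
  proof (rule second_deriv_nonpos_at_local_max[where r="r - \<bar>y - y0\<bar>" and x=y
        and h="\<lambda>t. w (x, t) - g (t - y0)" and h'="\<lambda>t. wy (x, t) - g' (t - y0)"])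
    show "r - \<bar>y - y0\<bar> > 0" using y by simp
    show "((\<lambda>t. w (x, t) - g (t - y0)) has_real_derivative wy (x, t) - g' (t - y0)) (at t)"
      if "\<bar>t - y\<bar> < r - \<bar>y - y0\<bar>" for t
    proof -
      have "\<bar>t - y0\<bar> < R" using that r by linarith
      then show ?thesis by (intro DERIV_diff wy g_shift)
    qed
    have "\<bar>y - y0\<bar> < R" using y r by linarith
    then show "((\<lambda>t. wy (x, t) - g' (t - y0)) has_real_derivative wyy (x, y) - g'' (y - y0)) (at y)"
      by (intro DERIV_diff wyy g_shift)
    show "w (x, t) - g (t - y0) \<le> w (x, y) - g (y - y0)" if "\<bar>t - y\<bar> < r - \<bar>y - y0\<bar>" for t
    proof -
      have "(x, t) \<in> C" using that x unfolding memC by linarith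
      from zm(2)[OF this] show ?thesis by (simp add: h_def xy)
    qed
  qed
  moreover have "g'' (x - x0) \<le> \<alpha> * (g (x - x0))\<^sup>2" "g'' (y - y0) \<le> \<alpha> * (g (y - y0))\<^sup>2"
    using g(3)[of "x - x0"] g(3)[of "y - y0"] x y r by auto
  moreover have "\<alpha> * (g (x - x0))\<^sup>2 + \<alpha> * (g (y - y0))\<^sup>2 < \<alpha> * (w (x, y))\<^sup>2"
  proof -
    have "(g (x - x0))\<^sup>2 + (g (y - y0))\<^sup>2 \<le> (g (x - x0) + g (y - y0))\<^sup>2"
      using g_nonneg by (simp add: power2_sum)
    also have "\<dots> < (w (x, y))\<^sup>2"
      using h g_nonneg by (intro power_strict_mono) auto
    finally show ?thesis using \<open>\<alpha> > 0\<close> by (simp flip: distrib_left)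
  qed
  moreover have "wxx (x, y) + wyy (x, y) \<ge> \<alpha> * (w (x, y))\<^sup>2"
    using h g_nonneg[of "x - x0"] g_nonneg[of "y - y0"] by (intro ineq) linarith
  ultimately show False by linarith
qed

section \<open>Cutoffs and weights\<close>

text \<open>A polynomial that vanishes to first order on the boundary of the square, which is what the
  weighted divergence identity asks for.\<close>
definition cutoff :: "real \<Rightarrow> real \<times> real \<Rightarrow> real"
  where "cutoff S z = (1 - (fst z)\<^sup>2 / S\<^sup>2) * (1 - (snd z)\<^sup>2 / S\<^sup>2)"
definition cutoff_x :: "real \<Rightarrow> real \<times> real \<Rightarrow> real"
  where "cutoff_x S z = - (2 * fst z / S\<^sup>2) * (1 - (snd z)\<^sup>2 / S\<^sup>2)"
definition cutoff_y :: "real \<Rightarrow> real \<times> real \<Rightarrow> real"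
  where "cutoff_y S z = - (2 * snd z / S\<^sup>2) * (1 - (fst z)\<^sup>2 / S\<^sup>2)"
text \<open>The factor \<open>f\<close> of the Pohozaev field \<open>f(x) x\<close>. Its gradient is \<open>- 2 f\<^sup>2 x / a\<^sup>2\<close>, and the
  divergence of the field is \<open>2 f\<^sup>2\<close>.\<close>
definition weight :: "real \<Rightarrow> real \<times> real \<Rightarrow> real"
  where "weight a z = a\<^sup>2 / (a\<^sup>2 + ((fst z)\<^sup>2 + (snd z)\<^sup>2))"

lemma cutoff_deriv:
  "((\<lambda>t. cutoff S (t, y)) has_real_derivative cutoff_x S (x, y)) (at x)"
  "((\<lambda>t. cutoff S (x, t)) has_real_derivative cutoff_y S (x, y)) (at y)"
  by (cases "S = 0"; auto simp: cutoff_def cutoff_x_def cutoff_y_def field_simps intro!: derivative_eq_intros)+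

lemma cutoff_cont:
  "continuous_on UNIV (cutoff S)" "continuous_on UNIV (cutoff_x S)" "continuous_on UNIV (cutoff_y S)"
  by (cases "S = 0"; auto simp: cutoff_def[abs_def] cutoff_x_def[abs_def] cutoff_y_def[abs_def]
      intro!: continuous_intros)+

lemma cutoff_boundary:
  "S > 0 \<Longrightarrow> cutoff S (S, y) = 0" "S > 0 \<Longrightarrow> cutoff S (-S, y) = 0"
  "S > 0 \<Longrightarrow> cutoff S (x, S) = 0" "S > 0 \<Longrightarrow> cutoff S (x, -S) = 0"
  by (simp_all add: cutoff_def)

lemma sq_ratio: assumes "\<bar>t\<bar> \<le> S" "S > 0" shows "0 \<le> 1 - t\<^sup>2 / S\<^sup>2" "1 - t\<^sup>2 / S\<^sup>2 \<le> (1::real)"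
  using assms power_mono[of "\<bar>t\<bar>" S 2] by simp_all

lemma cutoff_bounds:
  assumes "z \<in> Q S" "S > 0"
  shows "0 \<le> cutoff S z" "cutoff S z \<le> 1"
    "\<bar>cutoff_x S z\<bar> \<le> 2 * \<bar>fst z\<bar> / S\<^sup>2" "\<bar>cutoff_y S z\<bar> \<le> 2 * \<bar>snd z\<bar> / S\<^sup>2"
    "\<bar>cutoff_x S z\<bar> \<le> 2 / S" "\<bar>cutoff_y S z\<bar> \<le> 2 / S"
proof -
  have z: "\<bar>fst z\<bar> \<le> S" "\<bar>snd z\<bar> \<le> S" using assms by (auto simp: mem_Q)
  note r = sq_ratio[OF z(1) assms(2)] sq_ratio[OF z(2) assms(2)]
  show "0 \<le> cutoff S z" "cutoff S z \<le> 1"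
    using r by (auto simp: cutoff_def intro: mult_le_one)
  show 1: "\<bar>cutoff_x S z\<bar> \<le> 2 * \<bar>fst z\<bar> / S\<^sup>2"
    using mult_left_mono[OF r(4), of "2 * \<bar>fst z\<bar> / S\<^sup>2"] r(3) by (simp add: cutoff_x_def abs_mult)
  show 2: "\<bar>cutoff_y S z\<bar> \<le> 2 * \<bar>snd z\<bar> / S\<^sup>2"
    using mult_left_mono[OF r(2), of "2 * \<bar>snd z\<bar> / S\<^sup>2"] r(1) by (simp add: cutoff_y_def abs_mult)
  have "2 * \<bar>t\<bar> / S\<^sup>2 \<le> 2 / S" if "\<bar>t\<bar> \<le> S" for t
    using that \<open>S > 0\<close> by (simp add: field_simps power2_eq_square)
  with 1 2 z show "\<bar>cutoff_x S z\<bar> \<le> 2 / S" "\<bar>cutoff_y S z\<bar> \<le> 2 / S" by fastforce+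
qed

lemma cutoff_ge_half: "cutoff S z \<ge> 1 / 2" if "z \<in> Q L" "2 * L \<le> S" "S > 0"
proof -
  have *: "3 / 4 \<le> 1 - t\<^sup>2 / S\<^sup>2" if "\<bar>t\<bar> \<le> L" for t
  proof -
    have "t\<^sup>2 \<le> (S / 2)\<^sup>2" using power_mono[of "\<bar>t\<bar>" "S / 2" 2] that \<open>2 * L \<le> S\<close> by simp
    then show ?thesis using \<open>S > 0\<close> by (simp add: field_simps power2_eq_square)
  qed
  have "(3 / 4) * (3 / 4) \<le> cutoff S z"
    unfolding cutoff_def using that(1) by (intro mult_mono order_trans[OF _ *, of 0] * ) (simp_all add: mem_Q)
  then show ?thesis by simp
qed

lemma integral_cutoff_ge: "S > 0 \<Longrightarrow> integral (Q S) (cutoff S) \<ge> S\<^sup>2 / 2"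
proof -
  assume S: "S > 0"
  have "S\<^sup>2 / 2 = integral (Q (S / 2)) (\<lambda>z. 1 / 2)" using S by (subst integral_Q_const) (auto simp: power2_eq_square)
  also have "\<dots> \<le> integral (Q (S / 2)) (cutoff S)"
    using S by (intro integral_Q_mono cutoff_cont cutoff_ge_half[where L="S/2"]) auto
  also have "\<dots> \<le> integral (Q S) (cutoff S)"
    using S by (intro integral_Q_subset cutoff_cont cutoff_bounds) auto
  finally show ?thesis .
qed

text \<open>The size of the trace-free part of the derivative of the Pohozaev field, up to a constant: the
  weight with which the gradient terms enter the Pohozaev identity.\<close>
definition remainder_weight :: "real \<Rightarrow> real \<times> real \<Rightarrow> real"
  where "remainder_weight a z = (weight a z)\<^sup>2 * ((fst z)\<^sup>2 + (snd z)\<^sup>2) / a\<^sup>2"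

context
  fixes a :: real
  assumes a: "a > 0"
begin

lemma weight_pos: "weight a z > 0" and weight_le1: "weight a z \<le> 1"
  using a by (auto simp: weight_def divide_simps add_pos_nonneg intro!: divide_pos_pos)

lemma weight_deriv:
  "((\<lambda>t. weight a (t, y)) has_real_derivative - 2 * x * (weight a (x, y))\<^sup>2 / a\<^sup>2) (at x)"
  "((\<lambda>t. weight a (x, t)) has_real_derivative - 2 * y * (weight a (x, y))\<^sup>2 / a\<^sup>2) (at y)"
proof -
  have "a\<^sup>2 + (x\<^sup>2 + y\<^sup>2) \<noteq> 0" using a by (simp add: add_pos_nonneg less_imp_neq[THEN not_sym])
  then show "((\<lambda>t. weight a (t, y)) has_real_derivative - 2 * x * (weight a (x, y))\<^sup>2 / a\<^sup>2) (at x)"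
  "((\<lambda>t. weight a (x, t)) has_real_derivative - 2 * y * (weight a (x, y))\<^sup>2 / a\<^sup>2) (at y)"
    using a unfolding weight_def by (auto intro!: derivative_eq_intros simp: power2_eq_square)
qed

lemma weight_cont: "continuous_on UNIV (weight a)"
proof -
  have "a\<^sup>2 + ((fst z)\<^sup>2 + (snd z)\<^sup>2) \<noteq> 0" for z :: "real \<times> real"
    using a by (simp add: add_pos_nonneg less_imp_neq[THEN not_sym])
  then show ?thesis unfolding weight_def[abs_def] by (auto intro!: continuous_intros)
qed

lemma weight_mult_r2: "weight a z * ((fst z)\<^sup>2 + (snd z)\<^sup>2) = a\<^sup>2 * (1 - weight a z)"
proof -
  have "a\<^sup>2 + ((fst z)\<^sup>2 + (snd z)\<^sup>2) \<noteq> 0"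
    using a by (simp add: add_pos_nonneg less_imp_neq[THEN not_sym])
  then show ?thesis by (simp add: weight_def field_simps)
qed

lemma weight_mult_coord: "weight a z * \<bar>fst z\<bar> \<le> a / 2" "weight a z * \<bar>snd z\<bar> \<le> a / 2"
proof -
  have p: "a\<^sup>2 + ((fst z)\<^sup>2 + (snd z)\<^sup>2) > 0" using a by (simp add: add_pos_nonneg)
  have "2 * a * \<bar>fst z\<bar> \<le> a\<^sup>2 + ((fst z)\<^sup>2 + (snd z)\<^sup>2)"
    using sum_squares_bound[of a "\<bar>fst z\<bar>"] zero_le_power2[of "snd z"] unfolding power2_abs by linarith
  from mult_left_mono[OF this, of a]
  show "weight a z * \<bar>fst z\<bar> \<le> a / 2" using p a by (simp add: weight_def field_simps power2_eq_square)
  have "2 * a * \<bar>snd z\<bar> \<le> a\<^sup>2 + ((fst z)\<^sup>2 + (snd z)\<^sup>2)"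
    using sum_squares_bound[of a "\<bar>snd z\<bar>"] zero_le_power2[of "fst z"] unfolding power2_abs by linarith
  from mult_left_mono[OF this, of a]
  show "weight a z * \<bar>snd z\<bar> \<le> a / 2" using p a by (simp add: weight_def field_simps power2_eq_square)
qed

lemma weight_sq_ge: "(weight a z)\<^sup>2 \<ge> 1 / 4" if "z \<in> Q L" "2 * L \<le> a"
proof -
  have "(fst z)\<^sup>2 \<le> a\<^sup>2 / 4" "(snd z)\<^sup>2 \<le> a\<^sup>2 / 4"
    using that power_mono[of "\<bar>fst z\<bar>" "a / 2" 2] power_mono[of "\<bar>snd z\<bar>" "a / 2" 2] by (auto simp: mem_Q power_divide)
  then have "(fst z)\<^sup>2 + (snd z)\<^sup>2 \<le> a\<^sup>2" using zero_le_power2[of a] by linarith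
  then have "1 / 2 \<le> weight a z"
    using a by (simp add: weight_def add_pos_nonneg pos_le_divide_eq)
  from power_mono[OF this, of 2] show ?thesis by (simp add: power2_eq_square)
qed

lemma remainder_weight_cont: "continuous_on UNIV (remainder_weight a)"
  unfolding remainder_weight_def[abs_def] using a by (auto intro!: continuous_intros weight_cont)

lemma remainder_weight_bounds:
  "0 \<le> remainder_weight a z" "remainder_weight a z \<le> 1"
  "remainder_weight a z \<le> ((fst z)\<^sup>2 + (snd z)\<^sup>2) / a\<^sup>2"
proof -
  show "0 \<le> remainder_weight a z" by (simp add: remainder_weight_def)
  have "remainder_weight a z = weight a z * (1 - weight a z)"
    using arg_cong[OF weight_mult_r2[of z], of "\<lambda>t. weight a z * t / a\<^sup>2"] a
    by (simp add: remainder_weight_def power2_eq_square)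
  also have "\<dots> \<le> 1 * 1" using weight_pos[of z] weight_le1[of z] by (intro mult_mono) auto
  finally show "remainder_weight a z \<le> 1" by simp
  have "(weight a z)\<^sup>2 \<le> 1" using weight_pos[of z] weight_le1[of z] by (simp add: power_le_one less_imp_le)
  then show "remainder_weight a z \<le> ((fst z)\<^sup>2 + (snd z)\<^sup>2) / a\<^sup>2"
    unfolding remainder_weight_def by (intro divide_right_mono mult_left_le_one_le) auto
qed

end

text \<open>The contraction of the stress tensor \<open>(D - W, M; M, - D - W)\<close> with the derivative of the field
  \<open>\<zeta> f (x, y)\<close>, at one point; \<open>\<zeta>\<close> is the value of the cutoff and \<open>cx\<close>, \<open>cy\<close> are its partial
  derivatives. Without the cutoff the trace contributes \<open>- 2 W f\<^sup>2\<close>, and the trace-free part has size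
  \<open>f\<^sup>2 (x\<^sup>2 + y\<^sup>2) / a\<^sup>2\<close>. Derivatives of the cutoff come with \<open>f (x\<^sup>2 + y\<^sup>2) / S\<^sup>2 \<le> a\<^sup>2 / S\<^sup>2\<close>.\<close>
lemma pohozaev_pointwise:
  fixes D M W \<zeta> cx cy f a S x y e :: real
  assumes D: "\<bar>D\<bar> \<le> e / 2" and M: "\<bar>M\<bar> \<le> e / 2" and \<zeta>: "0 \<le> \<zeta>" "\<zeta> \<le> 1"
    and cx: "\<bar>cx\<bar> \<le> 2 * \<bar>x\<bar> / S\<^sup>2" and cy: "\<bar>cy\<bar> \<le> 2 * \<bar>y\<bar> / S\<^sup>2"
    and f: "f > 0" "f \<le> 1" "f * (x\<^sup>2 + y\<^sup>2) = a\<^sup>2 * (1 - f)" and pos: "a > 0" "S > 0"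
  defines "gx \<equiv> cx * f * x + \<zeta> * (- 2 * x * f\<^sup>2 / a\<^sup>2) * x + \<zeta> * f"
    and "gy \<equiv> cy * f * x + \<zeta> * (- 2 * y * f\<^sup>2 / a\<^sup>2) * x"
    and "hx \<equiv> cx * f * y + \<zeta> * (- 2 * x * f\<^sup>2 / a\<^sup>2) * y"
    and "hy \<equiv> cy * f * y + \<zeta> * (- 2 * y * f\<^sup>2 / a\<^sup>2) * y + \<zeta> * f"
  shows "\<bar>D * (gx - hy) + M * (gy + hx) - W * (gx + hy) + 2 * (W * (\<zeta> * f\<^sup>2))\<bar>
    \<le> 2 * (e * (f\<^sup>2 * (x\<^sup>2 + y\<^sup>2) / a\<^sup>2)) + 2 * (a\<^sup>2 / S\<^sup>2 * (e + \<bar>W\<bar>))"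
proof -
  define r where "r = f\<^sup>2 * (x\<^sup>2 + y\<^sup>2) / a\<^sup>2"
  have "r = f * (f * (x\<^sup>2 + y\<^sup>2)) / a\<^sup>2" by (simp add: r_def power2_eq_square)
  then have r: "r = f * (1 - f)" unfolding f(3) using pos by simp
  have e0: "e \<ge> 0" using D by linarith
  have frr: "f * (x\<^sup>2 + y\<^sup>2) \<le> a\<^sup>2"
    unfolding f(3) using f by (intro mult_left_le) auto
  define b where "b = 2 * (a\<^sup>2 / S\<^sup>2)"
  have b0: "b \<ge> 0" by (simp add: b_def)
  \<comment> \<open>Each combination of \<open>x\<close>, \<open>y\<close> with the derivatives of the cutoff is \<open>O((x\<^sup>2 + y\<^sup>2) / S\<^sup>2)\<close>; the
     factor \<open>f\<close> turns this into \<open>O(a\<^sup>2 / S\<^sup>2)\<close>.\<close>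
  have prod: "\<bar>f * (p * q + u * t)\<bar> \<le> b"
    if "\<bar>p\<bar> \<le> \<bar>q'\<bar>" and "\<bar>u\<bar> \<le> \<bar>t'\<bar>" and "\<bar>q\<bar> \<le> 2 * c1 / S\<^sup>2" "\<bar>t\<bar> \<le> 2 * c2 / S\<^sup>2"
      and "\<bar>q'\<bar> * c1 + \<bar>t'\<bar> * c2 \<le> x\<^sup>2 + y\<^sup>2" for p q u t q' t' c1 c2
  proof -
    have "\<bar>p * q + u * t\<bar> \<le> \<bar>p\<bar> * \<bar>q\<bar> + \<bar>u\<bar> * \<bar>t\<bar>" by (metis abs_mult abs_triangle_ineq)
    also have "\<dots> \<le> \<bar>q'\<bar> * (2 * c1 / S\<^sup>2) + \<bar>t'\<bar> * (2 * c2 / S\<^sup>2)" using that by (intro add_mono mult_mono) auto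
    also have "\<dots> = 2 / S\<^sup>2 * (\<bar>q'\<bar> * c1 + \<bar>t'\<bar> * c2)" by (simp add: algebra_simps add_divide_distrib)
    also have "\<dots> \<le> 2 / S\<^sup>2 * (x\<^sup>2 + y\<^sup>2)" using that by (intro mult_left_mono) auto
    finally have "f * \<bar>p * q + u * t\<bar> \<le> f * (2 / S\<^sup>2 * (x\<^sup>2 + y\<^sup>2))" using f by (intro mult_left_mono) auto
    also have "\<dots> = 2 / S\<^sup>2 * (f * (x\<^sup>2 + y\<^sup>2))" by simp
    also have "\<dots> \<le> 2 / S\<^sup>2 * a\<^sup>2" using frr by (intro mult_left_mono) auto
    finally show ?thesis using f by (simp add: b_def abs_mult)
  qed
  have sq: "\<bar>x\<bar> * \<bar>x\<bar> + \<bar>y\<bar> * \<bar>y\<bar> \<le> x\<^sup>2 + y\<^sup>2" "\<bar>x\<bar> * \<bar>y\<bar> + \<bar>y\<bar> * \<bar>x\<bar> \<le> x\<^sup>2 + y\<^sup>2"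
    using sum_squares_bound[of "\<bar>x\<bar>" "\<bar>y\<bar>"] by (simp_all add: power2_eq_square)
  have a1: "\<bar>f * (x * cx + (- y) * cy)\<bar> \<le> b"
    by (rule prod[where q'=x and t'=y, OF _ _ cx cy]) (use sq in auto)
  have a2: "\<bar>f * (y * cx + x * cy)\<bar> \<le> b"
    by (rule prod[where q'=y and t'=x, OF _ _ cx cy]) (use sq in \<open>auto simp: algebra_simps\<close>)
  have a3: "\<bar>f * (x * cx + y * cy)\<bar> \<le> b"
    by (rule prod[where q'=x and t'=y, OF _ _ cx cy]) (use sq in auto)
  have rot: "\<bar>\<zeta> * (2 * f\<^sup>2 * t / a\<^sup>2)\<bar> \<le> 2 * r" if "\<bar>t\<bar> \<le> x\<^sup>2 + y\<^sup>2" for t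
  proof -
    have "\<bar>\<zeta> * (2 * f\<^sup>2 * t / a\<^sup>2)\<bar> = \<zeta> * (2 * (f\<^sup>2 * \<bar>t\<bar> / a\<^sup>2))" using \<zeta> by (simp add: abs_mult)
    also have "\<dots> \<le> 1 * (2 * (f\<^sup>2 * (x\<^sup>2 + y\<^sup>2) / a\<^sup>2))"
      using \<zeta> that by (intro mult_mono divide_right_mono) auto
    finally show ?thesis by (simp add: r_def)
  qed
  have "gx - hy = f * (x * cx + (- y) * cy) - \<zeta> * (2 * f\<^sup>2 * (x\<^sup>2 - y\<^sup>2) / a\<^sup>2)"
    using pos by (simp add: gx_def hy_def field_simps power2_eq_square)
  moreover have "\<bar>x\<^sup>2 - y\<^sup>2\<bar> \<le> x\<^sup>2 + y\<^sup>2" by (simp add: abs_le_iff)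
  ultimately have 1: "\<bar>gx - hy\<bar> \<le> b + 2 * r" using a1 rot[of "x\<^sup>2 - y\<^sup>2"] by linarith
  have "gy + hx = f * (y * cx + x * cy) - \<zeta> * (2 * f\<^sup>2 * (2 * x * y) / a\<^sup>2)"
    using pos by (simp add: gy_def hx_def field_simps power2_eq_square)
  moreover have "\<bar>2 * x * y\<bar> \<le> x\<^sup>2 + y\<^sup>2" using sq(2) by (simp add: abs_mult)
  ultimately have 2: "\<bar>gy + hx\<bar> \<le> b + 2 * r" using a2 rot[of "2 * x * y"] by linarith
  have "gx + hy = f * (x * cx + y * cy) + 2 * \<zeta> * (f - r)"
    using pos by (simp add: gx_def hy_def r_def field_simps power2_eq_square)
  also have "f - r = f\<^sup>2" by (simp add: r power2_eq_square algebra_simps)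
  finally have g: "gx + hy = f * (x * cx + y * cy) + 2 * \<zeta> * f\<^sup>2" .
  have 3: "\<bar>gx + hy - 2 * \<zeta> * f\<^sup>2\<bar> \<le> b" unfolding g using a3 by linarith
  have "\<bar>D * (gx - hy)\<bar> \<le> e / 2 * (b + 2 * r)" unfolding abs_mult using D 1 e0 by (intro mult_mono) auto
  moreover have "\<bar>M * (gy + hx)\<bar> \<le> e / 2 * (b + 2 * r)" unfolding abs_mult using M 2 e0 by (intro mult_mono) auto
  moreover have "\<bar>W * (gx + hy - 2 * \<zeta> * f\<^sup>2)\<bar> \<le> \<bar>W\<bar> * b" unfolding abs_mult using 3 by (intro mult_left_mono) auto
  moreover have "D * (gx - hy) + M * (gy + hx) - W * (gx + hy) + 2 * (W * (\<zeta> * f\<^sup>2))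
      = D * (gx - hy) + M * (gy + hx) - W * (gx + hy - 2 * \<zeta> * f\<^sup>2)" by (simp add: algebra_simps)
  ultimately have "\<bar>D * (gx - hy) + M * (gy + hx) - W * (gx + hy) + 2 * (W * (\<zeta> * f\<^sup>2))\<bar>
      \<le> e / 2 * (b + 2 * r) + e / 2 * (b + 2 * r) + \<bar>W\<bar> * b" by linarith
  also have "\<dots> = 2 * (e * r) + b * (e + \<bar>W\<bar>)" by (simp add: algebra_simps)
  finally show ?thesis by (simp add: r_def b_def)
qed

text \<open>On a fixed square of radius \<open>L\<close> the total weight is at least \<open>1 / 8\<close> as soon as \<open>a\<close> and \<open>S\<close>
  are at least \<open>2 L\<close>, so the integral of \<open>F\<close> over that square is zero.\<close>
lemma vanishes_of_weighted_integral:
  fixes F :: "real \<times> real \<Rightarrow> real"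
  assumes cF: "continuous_on UNIV F" and F: "\<And>z. F z \<ge> 0"
    and small: "\<And>\<epsilon> L. \<epsilon> > 0 \<Longrightarrow> L > 0 \<Longrightarrow> \<exists>a\<ge>L. \<exists>S\<ge>L. integral (Q S) (\<lambda>z. F z * (cutoff S z * (weight a z)\<^sup>2)) \<le> \<epsilon>"
  shows "F z = 0"
proof -
  define L where "L = \<bar>fst z\<bar> + \<bar>snd z\<bar> + 1"
  have L: "L > 0" "z \<in> Q L" by (auto simp: L_def mem_Q)
  have "integral (Q L) F \<le> \<epsilon>" if "\<epsilon> > 0" for \<epsilon>
  proof -
    have "\<epsilon> / 8 > 0" "2 * L > 0" using that L by auto
    from small[OF this] obtain a S where aS: "a \<ge> 2 * L" "S \<ge> 2 * L"
      and I: "integral (Q S) (\<lambda>z. F z * (cutoff S z * (weight a z)\<^sup>2)) \<le> \<epsilon> / 8" by blast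
    have pos: "a > 0" "S > 0" using aS L by auto
    have c: "continuous_on UNIV (\<lambda>z. F z * (cutoff S z * (weight a z)\<^sup>2))"
      by (intro continuous_intros cF cutoff_cont weight_cont pos)
    have "integral (Q L) F / 8 = integral (Q L) (\<lambda>z. F z / 8)" by simp
    also have "\<dots> \<le> integral (Q L) (\<lambda>z. F z * (cutoff S z * (weight a z)\<^sup>2))"
    proof (rule integral_Q_mono[OF _ c])
      show "continuous_on UNIV (\<lambda>z. F z / 8)" by (intro continuous_intros cF) auto
      fix z assume z: "z \<in> Q L"
      have "1 / 2 * (1 / 4) \<le> cutoff S z * (weight a z)\<^sup>2"
        using cutoff_ge_half[OF z aS(2) pos(2)] weight_sq_ge[OF pos(1) z aS(1)]
        by (intro mult_mono) auto
      from mult_left_mono[OF this F[of z]] show "F z / 8 \<le> F z * (cutoff S z * (weight a z)\<^sup>2)" by simp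
    qed
    also have "\<dots> \<le> integral (Q S) (\<lambda>z. F z * (cutoff S z * (weight a z)\<^sup>2))"
      using aS L pos by (intro integral_Q_subset c) (auto intro!: mult_nonneg_nonneg F cutoff_bounds)
    finally show ?thesis using I by simp
  qed
  then have "integral (Q L) F \<le> 0" by (rule field_le_epsilon[of _ 0, simplified])
  moreover have "integral (Q L) F \<ge> 0" by (intro integral_nonneg integrable_Q cF) (use F in auto)
  ultimately have i0: "integral (cbox (-L, -L) (L, L)) F = 0" by (simp add: Q_def)
  have "(0, 0) \<in> box (-L, -L) (L, L)" using L by (auto simp: mem_box Basis_prod_def)
  then have ne: "box (-L, -L) (L, L) \<noteq> {}" by blast
  show ?thesis
    using integral_cbox_eq_0_iff[OF continuous_on_subset[OF cF subset_UNIV] ne] i0 F L(2)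
    by (simp add: Q_def)
qed

section \<open>The real system and its quadratic quantities\<close>

text \<open>The free parameter \<open>\<tau>\<close> is later taken proportional to the side of the square.\<close>
lemma young: "\<bar>a * b\<bar> \<le> \<tau> * b\<^sup>2 + a\<^sup>2 / (4 * \<tau>)" if "\<tau> > 0" for a b \<tau> :: real
proof -
  have "0 \<le> (2 * \<tau> * \<bar>b\<bar> - \<bar>a\<bar>)\<^sup>2 / (4 * \<tau>)" using that by simp
  also have "\<dots> = \<tau> * b\<^sup>2 + a\<^sup>2 / (4 * \<tau>) - \<bar>a * b\<bar>"
    using that by (simp add: power2_diff abs_mult field_simps) (simp add: power2_eq_square)
  finally show ?thesis by simp
qed

text \<open>The real form of the system: \<open>I\<close> indexes real and imaginary parts of the components, \<open>N\<close> stands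
  for \<open>n\<close>, and the other parameters are the first and second partial derivatives of \<open>v\<close>. Using
  \<open>vxy\<close> for both mixed derivatives builds in the symmetry of second derivatives.\<close>
locale gl_system =
  fixes I :: "'i set" and lam :: "'i \<Rightarrow> real" and N :: real
    and v vx vy vxx vxy vyy :: "'i \<Rightarrow> real \<times> real \<Rightarrow> real"
  assumes fin: "finite I" and N_pos: "N > 0" and lam_pos: "\<And>k. k \<in> I \<Longrightarrow> lam k > 0"
    and D_x: "\<And>k x y. k \<in> I \<Longrightarrow> ((\<lambda>t. v k (t, y)) has_real_derivative vx k (x, y)) (at x)"
    and D_y: "\<And>k x y. k \<in> I \<Longrightarrow> ((\<lambda>t. v k (x, t)) has_real_derivative vy k (x, y)) (at y)"
    and D_xx: "\<And>k x y. k \<in> I \<Longrightarrow> ((\<lambda>t. vx k (t, y)) has_real_derivative vxx k (x, y)) (at x)"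
    and D_xy: "\<And>k x y. k \<in> I \<Longrightarrow> ((\<lambda>t. vx k (x, t)) has_real_derivative vxy k (x, y)) (at y)"
    and D_yx: "\<And>k x y. k \<in> I \<Longrightarrow> ((\<lambda>t. vy k (t, y)) has_real_derivative vxy k (x, y)) (at x)"
    and D_yy: "\<And>k x y. k \<in> I \<Longrightarrow> ((\<lambda>t. vy k (x, t)) has_real_derivative vyy k (x, y)) (at y)"
    and cont: "\<And>k. k \<in> I \<Longrightarrow> continuous_on UNIV (v k)" "\<And>k. k \<in> I \<Longrightarrow> continuous_on UNIV (vx k)"
      "\<And>k. k \<in> I \<Longrightarrow> continuous_on UNIV (vy k)" "\<And>k. k \<in> I \<Longrightarrow> continuous_on UNIV (vxx k)"
      "\<And>k. k \<in> I \<Longrightarrow> continuous_on UNIV (vxy k)" "\<And>k. k \<in> I \<Longrightarrow> continuous_on UNIV (vyy k)"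
    and eqn: "\<And>k z. k \<in> I \<Longrightarrow> lam k * (vxx k z + vyy k z) = - (v k z * (N - (\<Sum>j\<in>I. (v j z)\<^sup>2)))"
    and energy: "\<exists>E. \<forall>S>0. integral (Q S) (\<lambda>z. \<Sum>k\<in>I. lam k * ((vx k z)\<^sup>2 + (vy k z)\<^sup>2)) \<le> E"
begin

definition "modsq z = (\<Sum>k\<in>I. (v k z)\<^sup>2)"
definition "modsq_x z = (\<Sum>k\<in>I. 2 * v k z * vx k z)"
definition "modsq_y z = (\<Sum>k\<in>I. 2 * v k z * vy k z)"
definition "edens z = (\<Sum>k\<in>I. lam k * ((vx k z)\<^sup>2 + (vy k z)\<^sup>2))"
definition "wmodsq z = (\<Sum>k\<in>I. lam k * (v k z)\<^sup>2)"
text \<open>The vector \<open>(flux_x, flux_y)\<close> is half the gradient of \<open>wmodsq\<close>; it is also the field produced by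
  testing the equations with the solution itself.\<close>
definition "flux_x z = (\<Sum>k\<in>I. lam k * v k z * vx k z)"
definition "flux_y z = (\<Sum>k\<in>I. lam k * v k z * vy k z)"
definition "flux_xx z = (\<Sum>k\<in>I. lam k * ((vx k z)\<^sup>2 + v k z * vxx k z))"
definition "flux_yy z = (\<Sum>k\<in>I. lam k * ((vy k z)\<^sup>2 + v k z * vyy k z))"

lemma cont_modsq: "continuous_on UNIV modsq" and cont_modsq_x: "continuous_on UNIV modsq_x" and cont_modsq_y: "continuous_on UNIV modsq_y"
  and cont_edens: "continuous_on UNIV edens" and cont_wmodsq: "continuous_on UNIV wmodsq"
  and cont_flux_x: "continuous_on UNIV flux_x" and cont_flux_y: "continuous_on UNIV flux_y"
  and cont_flux_xx: "continuous_on UNIV flux_xx" and cont_flux_yy: "continuous_on UNIV flux_yy"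
  unfolding modsq_def modsq_x_def modsq_y_def edens_def wmodsq_def flux_x_def flux_y_def flux_xx_def flux_yy_def
  by (intro continuous_intros cont; assumption)+

lemmas conts = cont_modsq cont_modsq_x cont_modsq_y cont_edens cont_wmodsq cont_flux_x cont_flux_y cont_flux_xx cont_flux_yy

lemma modsq_nonneg: "modsq z \<ge> 0" by (simp add: modsq_def sum_nonneg)
lemma edens_nonneg: "edens z \<ge> 0" using lam_pos by (force simp: edens_def intro!: sum_nonneg intro: less_imp_le)

lemma D_modsq: "((\<lambda>t. modsq (t, y)) has_real_derivative modsq_x (x, y)) (at x)"
    "((\<lambda>t. modsq (x, t)) has_real_derivative modsq_y (x, y)) (at y)"
  unfolding modsq_def modsq_x_def modsq_y_def
  by (intro DERIV_sum; auto intro!: derivative_eq_intros D_x D_y)+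

lemma D_wmodsq: "((\<lambda>t. wmodsq (t, y)) has_real_derivative 2 * flux_x (x, y)) (at x)"
    "((\<lambda>t. wmodsq (x, t)) has_real_derivative 2 * flux_y (x, y)) (at y)"
  unfolding wmodsq_def flux_x_def flux_y_def sum_distrib_left
  by (intro DERIV_sum; auto intro!: derivative_eq_intros D_x D_y)+

lemma D_flux: "((\<lambda>t. flux_x (t, y)) has_real_derivative flux_xx (x, y)) (at x)"
    "((\<lambda>t. flux_y (x, t)) has_real_derivative flux_yy (x, y)) (at y)"
  unfolding flux_x_def flux_y_def flux_xx_def flux_yy_def
  by (intro DERIV_sum; auto intro!: derivative_eq_intros D_x D_y D_xx D_yy simp: algebra_simps power2_eq_square)+

text \<open>This is the sum of the equations, each multiplied by \<open>v k\<close>. It carries both the upper bound on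
  the solution and the energy estimates.\<close>
lemma div_flux: "flux_xx z + flux_yy z = edens z - modsq z * (N - modsq z)"
proof -
  have "flux_xx z + flux_yy z = (\<Sum>k\<in>I. lam k * ((vx k z)\<^sup>2 + (vy k z)\<^sup>2) + v k z * (lam k * (vxx k z + vyy k z)))"
    unfolding flux_xx_def flux_yy_def sum.distrib[symmetric] by (intro sum.cong) (auto simp: algebra_simps)
  also have "\<dots> = (\<Sum>k\<in>I. lam k * ((vx k z)\<^sup>2 + (vy k z)\<^sup>2) - (v k z)\<^sup>2 * (N - modsq z))"
    by (intro sum.cong refl) (simp add: eqn modsq_def power2_eq_square)
  also have "\<dots> = edens z - modsq z * (N - modsq z)"
    by (simp add: sum_subtractf edens_def modsq_def sum_distrib_right)
  finally show ?thesis .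
qed

text \<open>Any positive upper bound of the coefficients would do; the summand \<open>1\<close> keeps it positive when
  \<open>I\<close> is empty.\<close>
definition "\<Lambda> = 1 + (\<Sum>k\<in>I. lam k)"

lemma \<Lambda>_ge1: "\<Lambda> \<ge> 1" using lam_pos by (force simp: \<Lambda>_def intro!: sum_nonneg intro: less_imp_le)

lemma lam_le: "k \<in> I \<Longrightarrow> lam k \<le> \<Lambda>"
  using member_le_sum[of k I lam] lam_pos fin by (force simp: \<Lambda>_def intro: less_imp_le)

lemma wmodsq_le: "wmodsq z \<le> \<Lambda> * modsq z"
  unfolding wmodsq_def modsq_def sum_distrib_left by (intro sum_mono mult_right_mono lam_le) auto

lemma flux_young:
  assumes "\<tau> > 0"
  shows "\<bar>flux_x z\<bar> + \<bar>flux_y z\<bar> \<le> \<tau> * edens z + \<Lambda> * modsq z / (2 * \<tau>)"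
proof -
  have "\<bar>flux_x z\<bar> + \<bar>flux_y z\<bar> \<le> (\<Sum>k\<in>I. \<bar>lam k * v k z * vx k z\<bar>) + (\<Sum>k\<in>I. \<bar>lam k * v k z * vy k z\<bar>)"
    unfolding flux_x_def flux_y_def by (intro add_mono sum_abs)
  also have "\<dots> = (\<Sum>k\<in>I. lam k * (\<bar>v k z * vx k z\<bar> + \<bar>v k z * vy k z\<bar>))"
    unfolding sum.distrib[symmetric] using lam_pos
    by (intro sum.cong) (auto simp: abs_mult algebra_simps less_imp_le)
  also have "\<dots> \<le> (\<Sum>k\<in>I. lam k * ((\<tau> * (vx k z)\<^sup>2 + (v k z)\<^sup>2 / (4 * \<tau>)) + (\<tau> * (vy k z)\<^sup>2 + (v k z)\<^sup>2 / (4 * \<tau>))))"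
    using lam_pos assms by (intro sum_mono mult_left_mono add_mono young) (auto intro: less_imp_le)
  also have "\<dots> = \<tau> * edens z + wmodsq z / (2 * \<tau>)"
    unfolding edens_def wmodsq_def sum_distrib_left sum_divide_distrib sum.distrib[symmetric]
    using assms by (intro sum.cong) (auto simp: field_simps)
  also have "\<dots> \<le> \<tau> * edens z + \<Lambda> * modsq z / (2 * \<tau>)"
    using wmodsq_le assms by (simp add: divide_right_mono)
  finally show ?thesis .
qed

definition "\<Lambda>' = (\<Sum>k\<in>I. 1 / lam k)"

lemma \<Lambda>'_nonneg: "\<Lambda>' \<ge> 0" using lam_pos by (force simp: \<Lambda>'_def intro!: sum_nonneg intro: less_imp_le)

lemma modsq_young:
  assumes "\<tau> > 0"
  shows "\<bar>modsq_x z\<bar> + \<bar>modsq_y z\<bar> \<le> \<tau> * edens z + 2 * \<Lambda>' * modsq z / \<tau>"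
proof -
  have "\<bar>modsq_x z\<bar> + \<bar>modsq_y z\<bar> \<le> (\<Sum>k\<in>I. \<bar>2 * v k z * vx k z\<bar>) + (\<Sum>k\<in>I. \<bar>2 * v k z * vy k z\<bar>)"
    unfolding modsq_x_def modsq_y_def by (intro add_mono sum_abs)
  also have "\<dots> = (\<Sum>k\<in>I. \<bar>(2 * v k z) * vx k z\<bar> + \<bar>(2 * v k z) * vy k z\<bar>)"
    unfolding sum.distrib[symmetric] by simp
  also have "\<dots> \<le> (\<Sum>k\<in>I. ((\<tau> * lam k) * (vx k z)\<^sup>2 + (2 * v k z)\<^sup>2 / (4 * (\<tau> * lam k)))
      + ((\<tau> * lam k) * (vy k z)\<^sup>2 + (2 * v k z)\<^sup>2 / (4 * (\<tau> * lam k))))"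
    using lam_pos assms by (intro sum_mono add_mono young) auto
  also have "\<dots> = \<tau> * edens z + (\<Sum>k\<in>I. (2 / \<tau>) * ((v k z)\<^sup>2 * (1 / lam k)))"
    unfolding edens_def sum_distrib_left sum.distrib[symmetric]
    using assms lam_pos by (intro sum.cong) (auto simp: field_simps)
  also have "\<dots> \<le> \<tau> * edens z + (\<Sum>k\<in>I. (2 / \<tau>) * (modsq z * (1 / lam k)))"
    using assms lam_pos fin unfolding modsq_def
    by (intro add_mono order_refl sum_mono mult_left_mono mult_right_mono member_le_sum) (auto intro: less_imp_le)
  also have "(\<Sum>k\<in>I. (2 / \<tau>) * (modsq z * (1 / lam k))) = 2 * \<Lambda>' * modsq z / \<tau>"
    unfolding \<Lambda>'_def by (simp add: sum_distrib_left sum_distrib_right sum_divide_distrib mult_ac)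
  finally show ?thesis .
qed

section \<open>Boundedness and dispersion of the energy\<close>

text \<open>As \<open>wmodsq \<le> \<Lambda> * modsq\<close>, the quantity \<open>q = wmodsq / \<Lambda> - N\<close> is at most \<open>modsq - N\<close>. Where it is
  positive, \<open>\<Delta>wmodsq \<ge> 2 modsq (modsq - N) \<ge> 2 q\<^sup>2\<close>, so Keller--Osserman applies to \<open>wmodsq - \<Lambda> * N\<close>.\<close>
lemma modsq_bounded: "\<exists>B>0. \<forall>z. modsq z \<le> B"
proof -
  have pos: "\<Lambda> > 0" using \<Lambda>_ge1 by linarith
  have *: "wmodsq z - \<Lambda> * N \<le> 0" for z
  proof (rule keller_osserman[where wx="\<lambda>z. 2 * flux_x z" and wy="\<lambda>z. 2 * flux_y z"
        and wxx="\<lambda>z. 2 * flux_xx z" and wyy="\<lambda>z. 2 * flux_yy z" and w="\<lambda>z. wmodsq z - \<Lambda> * N" and \<alpha>="2 / \<Lambda>\<^sup>2"])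
    fix z assume z: "wmodsq z - \<Lambda> * N > 0"
    define q where "q = (wmodsq z - \<Lambda> * N) / \<Lambda>"
    have q: "q > 0" using z pos by (simp add: q_def)
    have "q = wmodsq z / \<Lambda> - N" using pos by (simp add: q_def field_simps)
    also have "wmodsq z / \<Lambda> \<le> modsq z" using wmodsq_le[of z] pos by (simp add: field_simps)
    finally have qs: "q \<le> modsq z - N" by simp
    have "2 / \<Lambda>\<^sup>2 * (wmodsq z - \<Lambda> * N)\<^sup>2 = 2 * (q * q)" using pos by (simp add: q_def power2_eq_square)
    also have "\<dots> \<le> 2 * (modsq z * (modsq z - N))"
      using q qs N_pos by (intro mult_left_mono mult_mono) auto
    also have "\<dots> \<le> 2 * flux_xx z + 2 * flux_yy z"
      using div_flux[of z] edens_nonneg[of z] by (simp add: algebra_simps)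
    finally show "2 / \<Lambda>\<^sup>2 * (wmodsq z - \<Lambda> * N)\<^sup>2 \<le> 2 * flux_xx z + 2 * flux_yy z" .
  qed (use pos in \<open>auto intro!: derivative_eq_intros D_wmodsq D_flux continuous_intros cont_wmodsq\<close>)
  define m where "m = Min (insert 1 (lam ` I))"
  have m: "m > 0" "\<And>k. k \<in> I \<Longrightarrow> m \<le> lam k"
    using lam_pos fin by (auto simp: m_def)
  have "modsq z \<le> \<Lambda> * N / m" for z
  proof -
    have "m * modsq z \<le> wmodsq z"
      unfolding modsq_def wmodsq_def sum_distrib_left using m by (intro sum_mono mult_right_mono) auto
    with *[of z] have "m * modsq z \<le> \<Lambda> * N" by simp
    then show ?thesis using m by (simp add: field_simps)
  qed
  moreover have "\<Lambda> * N / m > 0" using pos N_pos m by simp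
  ultimately show ?thesis by blast
qed

lemma energy_bound: "\<exists>E\<ge>0. \<forall>S>0. integral (Q S) edens \<le> E"
proof -
  obtain E where E: "\<And>S. S > 0 \<Longrightarrow> integral (Q S) edens \<le> E"
    using energy unfolding edens_def[abs_def] by blast
  have "0 \<le> integral (Q 1) edens" by (intro integral_nonneg integrable_Q cont_edens edens_nonneg)
  with E[of 1] have "0 \<le> E" by linarith
  with E show ?thesis by blast
qed

text \<open>The energies in the squares are increasing and bounded, hence nearly exhausted at some finite
  size.\<close>
lemma energy_tail:
  assumes "\<epsilon> > 0"
  shows "\<exists>M>0. \<forall>S>0. integral (Q S) edens \<le> integral (Q M) edens + \<epsilon>"
proof -
  define A where "A = (\<lambda>S. integral (Q S) edens) ` {0<..}"
  obtain E where "\<And>S. S > 0 \<Longrightarrow> integral (Q S) edens \<le> E" using energy_bound by blast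
  then have bdd: "bdd_above A" by (intro bdd_aboveI[of _ E]) (auto simp: A_def)
  have "A \<noteq> {}" by (auto simp: A_def)
  moreover have "Sup A - \<epsilon> < Sup A" using assms by simp
  ultimately obtain b where "b \<in> A" "Sup A - \<epsilon> < b" using less_cSup_iff[OF _ bdd] by blast
  then obtain M where M: "M > 0" "Sup A - \<epsilon> < integral (Q M) edens" by (auto simp: A_def)
  have "integral (Q S) edens \<le> integral (Q M) edens + \<epsilon>" if "S > 0" for S
    using cSup_upper[OF _ bdd, of "integral (Q S) edens"] M that by (auto simp: A_def)
  with M show ?thesis by blast
qed

text \<open>Optimising the bound in \<open>\<tau>\<close> says \<open>g \<le> 2 \<surd>(C e)\<close>, so by Cauchy--Schwarz the integral of \<open>g\<close>
  over the square is \<open>O(S)\<close>. It is even \<open>o(S)\<close>: outside a fixed square the energy is small, and the fixed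
  square contributes only a constant. Choosing \<open>\<tau> = T * S\<close> with a large constant \<open>T\<close> plays the role of
  Cauchy--Schwarz.\<close>
lemma gradient_integral_small:
  fixes g :: "real \<times> real \<Rightarrow> real"
  assumes cg: "continuous_on UNIV g" and "C \<ge> 0"
    and bound: "\<And>\<tau> z. \<tau> > 0 \<Longrightarrow> g z \<le> \<tau> * edens z + C / \<tau>"
    and "\<epsilon> > 0"
  shows "\<exists>S0>0. \<forall>S\<ge>S0. integral (Q S) g \<le> \<epsilon> * S"
proof -
  define T where "T = 16 * C / \<epsilon> + 1"
  have T: "T \<ge> 1" "16 * C \<le> \<epsilon> * T" using \<open>C \<ge> 0\<close> \<open>\<epsilon> > 0\<close> by (auto simp: T_def field_simps)
  obtain M where M: "M > 0" "\<And>S. S > 0 \<Longrightarrow> integral (Q S) edens \<le> integral (Q M) edens + \<epsilon> / (4 * T)"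
    using energy_tail[of "\<epsilon> / (4 * T)"] T \<open>\<epsilon> > 0\<close> by (metis divide_pos_pos less_le_trans mult_pos_pos zero_less_numeral zero_less_one)
  define c where "c = \<bar>integral (Q M) g\<bar>"
  define S0 where "S0 = max M (2 * c / \<epsilon>)"
  have "integral (Q S) g \<le> \<epsilon> * S" if "S \<ge> S0" for S
  proof -
    have S: "S \<ge> M" "S > 0" "2 * c / \<epsilon> \<le> S" using that M by (auto simp: S0_def)
    define \<tau> where "\<tau> = T * S"
    have \<tau>: "\<tau> > 0" using T S by (simp add: \<tau>_def)
    define h where "h z = \<tau> * edens z + C / \<tau> - g z" for z
    have ih: "integral (Q R) h = \<tau> * integral (Q R) edens + 4 * R\<^sup>2 * (C / \<tau>) - integral (Q R) g" if "R > 0" for R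
      unfolding h_def using that
      by (subst integral_diff integral_add; (intro integrable_Q continuous_intros cg cont_edens)?)+
        (simp add: integral_Q_const)
    have ch: "continuous_on UNIV h" unfolding h_def by (intro continuous_intros cg cont_edens)
    have "integral (Q M) h \<le> integral (Q S) h"
      using bound[OF \<tau>] S by (intro integral_Q_subset ch) (auto simp: h_def)
    then have "integral (Q S) g \<le> integral (Q M) g + \<tau> * (integral (Q S) edens - integral (Q M) edens)
        + 4 * S\<^sup>2 * (C / \<tau>) - 4 * M\<^sup>2 * (C / \<tau>)"
      using ih S M by (simp add: algebra_simps)
    also have "\<dots> \<le> c + \<tau> * (\<epsilon> / (4 * T)) + 4 * S\<^sup>2 * (C / \<tau>) - 0"
      using M(2)[OF S(2)] \<tau> \<open>C \<ge> 0\<close> by (intro diff_mono add_mono mult_left_mono) (auto simp: c_def)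
    also have "\<tau> * (\<epsilon> / (4 * T)) = \<epsilon> * S / 4" using T by (simp add: \<tau>_def)
    also have "4 * S\<^sup>2 * (C / \<tau>) \<le> \<epsilon> * S / 4"
      using T S mult_right_mono[OF T(2), of S] by (simp add: \<tau>_def field_simps power2_eq_square)
    also have "c \<le> \<epsilon> * S / 2" using S \<open>\<epsilon> > 0\<close> by (simp add: field_simps)
    finally show ?thesis by (simp add: mult.commute)
  qed
  moreover have "S0 > 0" using M by (simp add: S0_def)
  ultimately show ?thesis by blast
qed

lemma grad_modsq_integral_small: "\<epsilon> > 0 \<Longrightarrow> \<exists>S0>0. \<forall>S\<ge>S0. integral (Q S) (\<lambda>z. \<bar>modsq_x z\<bar> + \<bar>modsq_y z\<bar>) \<le> \<epsilon> * S"
proof -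
  assume "\<epsilon> > 0"
  obtain B where B: "B > 0" "\<And>z. modsq z \<le> B" using modsq_bounded by blast
  show ?thesis
  proof (rule gradient_integral_small[where C="2 * \<Lambda>' * B"])
    fix \<tau> :: real and z assume \<tau>: "\<tau> > 0"
    have "\<bar>modsq_x z\<bar> + \<bar>modsq_y z\<bar> \<le> \<tau> * edens z + 2 * \<Lambda>' * modsq z / \<tau>" by (rule modsq_young[OF \<tau>])
    also have "\<dots> \<le> \<tau> * edens z + 2 * \<Lambda>' * B / \<tau>"
      using \<tau> B(2)[of z] \<Lambda>'_nonneg by (intro add_left_mono divide_right_mono mult_left_mono) auto
    finally show "\<bar>modsq_x z\<bar> + \<bar>modsq_y z\<bar> \<le> \<tau> * edens z + 2 * \<Lambda>' * B / \<tau>" .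
  qed (use \<open>\<epsilon> > 0\<close> B \<Lambda>'_nonneg in \<open>auto intro!: continuous_intros conts\<close>)
qed

lemma flux_integral_small: "\<epsilon> > 0 \<Longrightarrow> \<exists>S0>0. \<forall>S\<ge>S0. integral (Q S) (\<lambda>z. \<bar>flux_x z\<bar> + \<bar>flux_y z\<bar>) \<le> \<epsilon> * S"
proof -
  assume "\<epsilon> > 0"
  obtain B where B: "B > 0" "\<And>z. modsq z \<le> B" using modsq_bounded by blast
  show ?thesis
  proof (rule gradient_integral_small[where C="\<Lambda> * B / 2"])
    fix \<tau> :: real and z assume \<tau>: "\<tau> > 0"
    have "\<bar>flux_x z\<bar> + \<bar>flux_y z\<bar> \<le> \<tau> * edens z + \<Lambda> * modsq z / (2 * \<tau>)" by (rule flux_young[OF \<tau>])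
    also have "\<dots> \<le> \<tau> * edens z + \<Lambda> * B / (2 * \<tau>)"
      using \<tau> B(2)[of z] \<Lambda>_ge1 by (intro add_left_mono divide_right_mono mult_left_mono) auto
    finally show "\<bar>flux_x z\<bar> + \<bar>flux_y z\<bar> \<le> \<tau> * edens z + \<Lambda> * B / 2 / \<tau>" by simp
  qed (use \<open>\<epsilon> > 0\<close> B \<Lambda>_ge1 in \<open>auto intro!: continuous_intros conts\<close>)
qed

text \<open>Dominated convergence by hand: the weight is at most \<open>1\<close>, which handles the tail of the energy,
  and at most \<open>2 M\<^sup>2 / a\<^sup>2\<close> on the square of radius \<open>M\<close>.\<close>
lemma remainder_integral_small:
  assumes "\<epsilon> > 0"
  shows "\<exists>a0>0. \<forall>a\<ge>a0. \<forall>S>0. integral (Q S) (\<lambda>z. edens z * remainder_weight a z) \<le> \<epsilon>"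
proof -
  obtain M where M: "M > 0" "\<And>S. S > 0 \<Longrightarrow> integral (Q S) edens \<le> integral (Q M) edens + \<epsilon> / 2"
    using energy_tail[of "\<epsilon> / 2"] assms by auto
  define J where "J = integral (Q M) edens"
  have J: "J \<ge> 0" unfolding J_def by (intro integral_nonneg integrable_Q cont_edens edens_nonneg)
  define a0 where "a0 = sqrt (4 * M\<^sup>2 * (J + 1) / \<epsilon>)"
  have a0: "a0 > 0" using M J assms by (simp add: a0_def)
  have a02: "a0\<^sup>2 = 4 * M\<^sup>2 * (J + 1) / \<epsilon>" using M J assms by (simp add: a0_def)
  have "integral (Q S) (\<lambda>z. edens z * remainder_weight a z) \<le> \<epsilon>" if a: "a \<ge> a0" and S: "S > 0" for a S
  proof -
    have ap: "a > 0" using a a0 by simp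
    define h where "h z = edens z * (1 - remainder_weight a z)" for z
    have cr: "continuous_on UNIV (\<lambda>z. edens z * remainder_weight a z)"
      by (intro continuous_intros cont_edens remainder_weight_cont ap)
    have ch: "continuous_on UNIV h"
      unfolding h_def by (intro continuous_intros cont_edens remainder_weight_cont ap)
    have ih: "integral (Q R) (\<lambda>z. edens z * remainder_weight a z) = integral (Q R) edens - integral (Q R) h" for R
    proof -
      have "integral (Q R) edens - integral (Q R) h = integral (Q R) (\<lambda>z. edens z - h z)"
        by (intro integral_diff[symmetric] integrable_Q cont_edens ch)
      then show ?thesis by (simp add: h_def algebra_simps)
    qed
    have hn: "h z \<ge> 0" for z
      using edens_nonneg[of z] remainder_weight_bounds(2)[OF ap, of z] by (simp add: h_def)
    have inM: "integral (Q M) (\<lambda>z. edens z * remainder_weight a z) \<le> \<epsilon> / 2"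
    proof -
      have "integral (Q M) (\<lambda>z. edens z * remainder_weight a z) \<le> integral (Q M) (\<lambda>z. edens z * (2 * M\<^sup>2 / a\<^sup>2))"
      proof (rule integral_Q_mono[OF cr])
        show "continuous_on UNIV (\<lambda>z. edens z * (2 * M\<^sup>2 / a\<^sup>2))" by (intro continuous_intros cont_edens)
        fix z assume "z \<in> Q M"
        then have "(fst z)\<^sup>2 \<le> M\<^sup>2" "(snd z)\<^sup>2 \<le> M\<^sup>2"
          using power_mono[of "\<bar>fst z\<bar>" M 2] power_mono[of "\<bar>snd z\<bar>" M 2] by (auto simp: mem_Q)
        then have "((fst z)\<^sup>2 + (snd z)\<^sup>2) / a\<^sup>2 \<le> 2 * M\<^sup>2 / a\<^sup>2" by (intro divide_right_mono) auto
        with remainder_weight_bounds(3)[OF ap, of z]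
        show "edens z * remainder_weight a z \<le> edens z * (2 * M\<^sup>2 / a\<^sup>2)"
          by (intro mult_left_mono edens_nonneg) linarith
      qed
      also have "\<dots> = J * (2 * M\<^sup>2) / a\<^sup>2" by (simp add: J_def)
      also have "\<dots> \<le> J * (2 * M\<^sup>2) / a0\<^sup>2"
        using a a0 J by (intro divide_left_mono power_mono) auto
      also have "\<dots> = \<epsilon> / 2 * (J / (J + 1))"
      proof -
        have "J * (2 * M\<^sup>2) / (4 * M\<^sup>2 * J' / \<epsilon>) = \<epsilon> / 2 * (J / J')" if "J' > 0" for J'
          using M(1) assms that by (simp add: field_simps)
        then show ?thesis unfolding a02 using J by simp
      qed
      also have "\<dots> \<le> \<epsilon> / 2" using J assms by (intro mult_left_le) auto
      finally show ?thesis .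
    qed
    have nn: "0 \<le> edens z * remainder_weight a z" for z
      using edens_nonneg[of z] remainder_weight_bounds(1)[OF ap, of z] by simp
    show ?thesis
    proof (cases "M \<le> S")
      case True
      have "integral (Q M) h \<le> integral (Q S) h" by (intro integral_Q_subset ch hn True)
      then show ?thesis using ih[of S] ih[of M] inM M(2)[OF S] by linarith
    next
      case False
      then have "integral (Q S) (\<lambda>z. edens z * remainder_weight a z) \<le> integral (Q M) (\<lambda>z. edens z * remainder_weight a z)"
        by (intro integral_Q_subset cr nn) auto
      then show ?thesis using inM assms by linarith
    qed
  qed
  with a0 show ?thesis by blast
qed

text \<open>The Poincare inequality gives \<open>c\<close>, with mean oscillation tending to zero because the gradient of
  \<open>modsq\<close> has integral \<open>o(S)\<close>. Testing the divergence identity for the flux with the cutoff shows that the integral of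
  \<open>cutoff * modsq * (N - modsq)\<close> stays bounded, whereas replacing \<open>modsq\<close> by \<open>c\<close> produces
  \<open>c * (N - c)\<close> times a quantity of order \<open>S\<^sup>2\<close>.\<close>
lemma modsq_almost_constant:
  assumes "\<delta> > 0" and B: "\<And>z. modsq z \<le> B"
  shows "\<exists>S0>0. \<forall>S\<ge>S0. \<exists>c. 0 \<le> c \<and> c \<le> B \<and> integral (Q S) (\<lambda>z. \<bar>modsq z - c\<bar>) \<le> \<delta> * S\<^sup>2 \<and> \<bar>c * (N - c)\<bar> \<le> \<delta>"
proof -
  have B0: "B \<ge> 0" using B[of undefined] modsq_nonneg[of undefined] by linarith
  obtain E where E: "E \<ge> 0" "\<And>S. S > 0 \<Longrightarrow> integral (Q S) edens \<le> E" using energy_bound by blast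
  define K where "K = N + 2 * B"
  have K: "K > 0" using N_pos B0 by (simp add: K_def)
  define \<eta> where "\<eta> = min \<delta> (\<delta> / (4 * K))"
  have \<eta>: "\<eta> > 0" "\<eta> \<le> \<delta>" "K * \<eta> \<le> \<delta> / 4"
  proof -
    show "\<eta> > 0" "\<eta> \<le> \<delta>" using assms K by (auto simp: \<eta>_def)
    have "K * \<eta> \<le> K * (\<delta> / (4 * K))" using K by (intro mult_left_mono) (auto simp: \<eta>_def)
    then show "K * \<eta> \<le> \<delta> / 4" using K by simp
  qed
  obtain S1 where S1: "S1 > 0" "\<And>S. S \<ge> S1 \<Longrightarrow> integral (Q S) (\<lambda>z. \<bar>modsq_x z\<bar> + \<bar>modsq_y z\<bar>) \<le> \<eta> / 2 * S"
    using grad_modsq_integral_small[of "\<eta> / 2"] \<eta> by auto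
  obtain S2 where S2: "S2 > 0" "\<And>S. S \<ge> S2 \<Longrightarrow> integral (Q S) (\<lambda>z. \<bar>flux_x z\<bar> + \<bar>flux_y z\<bar>) \<le> 1 * S"
    using flux_integral_small[of 1] by auto
  define S0 where "S0 = max (max S1 S2) (sqrt ((E + 2) * 4 / \<delta>))"
  have "\<exists>c. 0 \<le> c \<and> c \<le> B \<and> integral (Q S) (\<lambda>z. \<bar>modsq z - c\<bar>) \<le> \<delta> * S\<^sup>2 \<and> \<bar>c * (N - c)\<bar> \<le> \<delta>"
    if "S \<ge> S0" for S
  proof -
    have S: "S > 0" "S \<ge> S1" "S \<ge> S2" "sqrt ((E + 2) * 4 / \<delta>) \<le> S"
      using that S1 S2 by (auto simp: S0_def)
    have S2': "(E + 2) * 4 \<le> \<delta> * S\<^sup>2"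
    proof -
      have "(E + 2) * 4 / \<delta> = (sqrt ((E + 2) * 4 / \<delta>))\<^sup>2" using E assms by simp
      also have "\<dots> \<le> S\<^sup>2" using S E assms by (intro power_mono) auto
      finally show ?thesis using assms by (simp add: field_simps)
    qed
    obtain z0 where z0: "integral (Q S) (\<lambda>z. \<bar>modsq z - modsq z0\<bar>) \<le> 2 * S * integral (Q S) (\<lambda>z. \<bar>modsq_x z\<bar> + \<bar>modsq_y z\<bar>)"
      using square_poincare[OF D_modsq cont_modsq cont_modsq_x cont_modsq_y S(1)] by blast
    define c where "c = modsq z0"
    have c: "0 \<le> c" "c \<le> B" using modsq_nonneg B by (auto simp: c_def)
    have "2 * S * integral (Q S) (\<lambda>z. \<bar>modsq_x z\<bar> + \<bar>modsq_y z\<bar>) \<le> 2 * S * (\<eta> / 2 * S)"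
      using S1(2)[OF S(2)] S by (intro mult_left_mono) auto
    with z0 have osc: "integral (Q S) (\<lambda>z. \<bar>modsq z - c\<bar>) \<le> \<eta> * S\<^sup>2"
      by (simp add: c_def power2_eq_square algebra_simps)
    have csc: "continuous_on UNIV (\<lambda>z. \<bar>modsq z - c\<bar>)" by (intro continuous_intros cont_modsq)
    have zero: "integral (Q S) (\<lambda>z. cutoff S z * (flux_xx z + flux_yy z) + (cutoff_x S z * flux_x z + cutoff_y S z * flux_y z)) = 0"
      by (intro weighted_divergence D_flux cutoff_deriv conts cutoff_cont cutoff_boundary S)
    \<comment> \<open>The second summand integrates to zero, and adding it turns the first into something of lower order.\<close>
    define T where "T z = (c * (N - c)) * cutoff S z
      + (cutoff S z * (flux_xx z + flux_yy z) + (cutoff_x S z * flux_x z + cutoff_y S z * flux_y z))" for z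
    have cT: "continuous_on UNIV T"
      unfolding T_def by (intro continuous_intros conts cutoff_cont)
    have iT: "integral (Q S) T = c * (N - c) * integral (Q S) (cutoff S)"
      unfolding T_def using zero
      by (subst integral_add) (auto intro!: integrable_Q continuous_intros conts cutoff_cont)
    define U where "U z = edens z + (2 / S * (\<bar>flux_x z\<bar> + \<bar>flux_y z\<bar>) + K * \<bar>modsq z - c\<bar>)" for z
    have cU: "continuous_on UNIV U"
      unfolding U_def by (intro continuous_intros conts)
    have "\<bar>T z\<bar> \<le> U z" if "z \<in> Q S" for z
    proof -
      note b = cutoff_bounds[OF that S(1)]
      have "\<bar>(c - modsq z) * (N - modsq z - c)\<bar> \<le> \<bar>modsq z - c\<bar> * K"
        unfolding abs_mult using c B[of z] modsq_nonneg[of z] N_pos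
        by (intro mult_mono) (auto simp: K_def abs_minus_commute)
      moreover have "(c - modsq z) * (N - modsq z - c) = c * (N - c) - modsq z * (N - modsq z)"
        by (simp add: algebra_simps)
      ultimately have "cutoff S z * \<bar>c * (N - c) - modsq z * (N - modsq z)\<bar> \<le> 1 * (K * \<bar>modsq z - c\<bar>)"
        using b by (intro mult_mono) (auto simp: mult.commute)
      then have 1: "\<bar>cutoff S z * (c * (N - c) - modsq z * (N - modsq z))\<bar> \<le> K * \<bar>modsq z - c\<bar>"
        using b(1) by (simp add: abs_mult)
      have "\<bar>cutoff_x S z * flux_x z + cutoff_y S z * flux_y z\<bar> \<le> \<bar>cutoff_x S z\<bar> * \<bar>flux_x z\<bar> + \<bar>cutoff_y S z\<bar> * \<bar>flux_y z\<bar>"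
        by (metis abs_mult abs_triangle_ineq)
      also have "\<dots> \<le> 2 / S * \<bar>flux_x z\<bar> + 2 / S * \<bar>flux_y z\<bar>" by (intro add_mono mult_right_mono b) auto
      finally have 2: "\<bar>cutoff_x S z * flux_x z + cutoff_y S z * flux_y z\<bar> \<le> 2 / S * (\<bar>flux_x z\<bar> + \<bar>flux_y z\<bar>)"
        by (simp add: algebra_simps)
      have 3: "0 \<le> cutoff S z * edens z" "cutoff S z * edens z \<le> edens z"
        using b(1,2) edens_nonneg[of z] by (auto intro: mult_left_le_one_le)
      have "T z = cutoff S z * (c * (N - c) - modsq z * (N - modsq z)) + cutoff S z * edens z
          + (cutoff_x S z * flux_x z + cutoff_y S z * flux_y z)"
        unfolding T_def div_flux by (simp add: algebra_simps)
      then show ?thesis using 1 2 3 unfolding U_def by linarith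
    qed
    then have "\<bar>integral (Q S) T\<bar> \<le> integral (Q S) U"
      using integral_norm_bound_integral[OF integrable_Q[OF cT] integrable_Q[OF cU]] by simp
    also have "integral (Q S) U = integral (Q S) edens
        + (2 / S * integral (Q S) (\<lambda>z. \<bar>flux_x z\<bar> + \<bar>flux_y z\<bar>) + K * integral (Q S) (\<lambda>z. \<bar>modsq z - c\<bar>))"
      unfolding U_def
      by (subst integral_add, (intro integrable_Q continuous_intros conts)+,
          subst integral_add, (intro integrable_Q continuous_intros conts)+)
        (simp only: integral_mult_right)
    also have "\<dots> \<le> E + (2 / S * (1 * S) + K * (\<eta> * S\<^sup>2))"
      using S K by (intro add_mono mult_left_mono E S2 osc) auto
    also have "\<dots> = E + 2 + (K * \<eta>) * S\<^sup>2" using S by simp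
    also have "\<dots> \<le> \<delta> * S\<^sup>2 / 4 + \<delta> / 4 * S\<^sup>2"
      using S2' mult_right_mono[OF \<eta>(3), of "S\<^sup>2"] by (intro add_mono) auto
    finally have "\<bar>c * (N - c)\<bar> * \<bar>integral (Q S) (cutoff S)\<bar> \<le> \<delta> * (S\<^sup>2 / 2)"
      unfolding iT abs_mult by simp
    moreover have "\<bar>c * (N - c)\<bar> * (S\<^sup>2 / 2) \<le> \<bar>c * (N - c)\<bar> * \<bar>integral (Q S) (cutoff S)\<bar>"
      using integral_cutoff_ge[OF S(1)] by (intro mult_left_mono) auto
    ultimately have "\<bar>c * (N - c)\<bar> * (S\<^sup>2 / 2) \<le> \<delta> * (S\<^sup>2 / 2)" by linarith
    then have "\<bar>c * (N - c)\<bar> \<le> \<delta>" using S(1) by (simp add: mult_le_cancel_right)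
    moreover have "\<eta> * S\<^sup>2 \<le> \<delta> * S\<^sup>2" using \<eta> by (intro mult_right_mono) auto
    ultimately show ?thesis using c osc by (intro exI[of _ c]) auto
  qed
  moreover have "S0 > 0" using S1 by (simp add: S0_def)
  ultimately show ?thesis by blast
qed

text \<open>Subtracting a constant from the potential does not affect the equations; the constant is the
  mean value of the potential at infinity.\<close>
definition "V \<kappa> z = (N - modsq z)\<^sup>2 / 4 - \<kappa>"

lemma cont_V: "continuous_on UNIV (V \<kappa>)"
  unfolding V_def by (intro continuous_intros conts) auto

text \<open>Arbitrarily large squares, rather than all large ones, suffice for the Pohozaev argument and
  spare a proof that \<open>c\<close> cannot alternate between the two limits.\<close>
definition "potential_decays \<kappa> \<longleftrightarrow> (\<forall>\<epsilon>>0. \<forall>S1. \<exists>S\<ge>S1. S > 0 \<and> integral (Q S) (\<lambda>z. \<bar>V \<kappa> z\<bar>) \<le> \<epsilon> * S\<^sup>2)"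

lemma V_integral_le:
  assumes B: "\<And>z. modsq z \<le> B" and c: "0 \<le> c" "c \<le> B" and "S > 0"
  shows "integral (Q S) (\<lambda>z. \<bar>V \<kappa> z\<bar>) \<le> (N + B) / 2 * integral (Q S) (\<lambda>z. \<bar>modsq z - c\<bar>)
    + 4 * S\<^sup>2 * \<bar>(N - c)\<^sup>2 / 4 - \<kappa>\<bar>"
proof -
  have "integral (Q S) (\<lambda>z. \<bar>V \<kappa> z\<bar>)
      \<le> integral (Q S) (\<lambda>z. (N + B) / 2 * \<bar>modsq z - c\<bar> + \<bar>(N - c)\<^sup>2 / 4 - \<kappa>\<bar>)"
  proof (rule integral_Q_mono)
    fix z
    have "\<bar>(c - modsq z) * (2 * N - modsq z - c)\<bar> \<le> \<bar>modsq z - c\<bar> * (2 * (N + B))"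
      unfolding abs_mult using B[of z] c modsq_nonneg[of z] N_pos
      by (intro mult_mono) (auto simp: abs_minus_commute)
    moreover have "V \<kappa> z = (c - modsq z) * (2 * N - modsq z - c) / 4 + ((N - c)\<^sup>2 / 4 - \<kappa>)"
      by (simp add: V_def power2_eq_square field_simps)
    moreover have "\<bar>p / 4 + q\<bar> \<le> (N + B) / 2 * r + \<bar>q\<bar>" if "\<bar>p\<bar> \<le> r * (2 * (N + B))" for p q r :: real
    proof -
      have "r * (2 * (N + B)) = 4 * ((N + B) / 2 * r)" by simp
      with that show ?thesis by linarith
    qed
    ultimately show "\<bar>V \<kappa> z\<bar> \<le> (N + B) / 2 * \<bar>modsq z - c\<bar> + \<bar>(N - c)\<^sup>2 / 4 - \<kappa>\<bar>"
      by metis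
  qed (intro continuous_intros conts cont_V)+
  also have "\<dots> = (N + B) / 2 * integral (Q S) (\<lambda>z. \<bar>modsq z - c\<bar>) + 4 * S\<^sup>2 * \<bar>(N - c)\<^sup>2 / 4 - \<kappa>\<bar>"
    using \<open>S > 0\<close> by (subst integral_add, (intro integrable_Q continuous_intros conts)+)
      (simp only: integral_mult_right integral_Q_const)
  finally show ?thesis .
qed

text \<open>As \<open>c * (N - c)\<close> is small, either \<open>N - c\<close> or \<open>c\<close> is small. If the second alternative for the
  potential fails, then \<open>c\<close> is not small on any large square, so \<open>N - c\<close> is small on all of them.\<close>
lemma potential_dichotomy: "potential_decays 0 \<or> potential_decays (N\<^sup>2 / 4)"
proof (rule disjCI)
  assume "\<not> potential_decays (N\<^sup>2 / 4)"
  then obtain \<epsilon>1 R1 where \<epsilon>1: "\<epsilon>1 > 0"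
    and far: "\<And>S. S \<ge> R1 \<Longrightarrow> S > 0 \<Longrightarrow> integral (Q S) (\<lambda>z. \<bar>V (N\<^sup>2 / 4) z\<bar>) > \<epsilon>1 * S\<^sup>2"
    unfolding potential_decays_def by (meson linorder_not_le)
  obtain B where B: "B > 0" "\<And>z. modsq z \<le> B" using modsq_bounded by blast
  show "potential_decays 0"
    unfolding potential_decays_def
  proof (intro allI impI)
    fix \<epsilon> S1 :: real assume \<epsilon>: "\<epsilon> > 0"
    define m where "m = min \<epsilon> \<epsilon>1"
    define K where "K = (N + B) / 2 + 4 * (N + B) / N"
    define \<delta> where "\<delta> = m / K"
    have "N > 0" "m > 0" "K > 0" using N_pos B \<epsilon> \<epsilon>1 by (auto simp: m_def K_def intro!: add_pos_pos)
    then have \<delta>: "\<delta> > 0" "K * \<delta> = m" by (auto simp: \<delta>_def)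
    obtain S0 where S0: "S0 > 0"
      "\<And>S. S \<ge> S0 \<Longrightarrow> \<exists>c. 0 \<le> c \<and> c \<le> B \<and> integral (Q S) (\<lambda>z. \<bar>modsq z - c\<bar>) \<le> \<delta> * S\<^sup>2 \<and> \<bar>c * (N - c)\<bar> \<le> \<delta>"
      using modsq_almost_constant[OF \<delta>(1) B(2)] by blast
    define S where "S = max S0 (max S1 R1)"
    have S: "S \<ge> S0" "S \<ge> S1" "S \<ge> R1" "S > 0" using S0 by (auto simp: S_def)
    obtain c where c: "0 \<le> c" "c \<le> B" "integral (Q S) (\<lambda>z. \<bar>modsq z - c\<bar>) \<le> \<delta> * S\<^sup>2" "\<bar>c * (N - c)\<bar> \<le> \<delta>"
      using S0(2)[OF S(1)] by blast
    define t where "t = \<delta> / N"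
    have t: "t \<ge> 0" and dt: "\<delta> = N * t" using \<delta> N_pos by (auto simp: t_def)
    have key: "integral (Q S) (\<lambda>z. \<bar>V \<kappa> z\<bar>) \<le> m * S\<^sup>2"
      if "\<bar>(N - c)\<^sup>2 / 4 - \<kappa>\<bar> \<le> (N + B) * t" for \<kappa>
    proof -
      have "integral (Q S) (\<lambda>z. \<bar>V \<kappa> z\<bar>) \<le> (N + B) / 2 * (\<delta> * S\<^sup>2) + 4 * S\<^sup>2 * ((N + B) * t)"
        using N_pos B(1)
        by (intro order_trans[OF V_integral_le[OF B(2) c(1,2) S(4)]] add_mono mult_left_mono c(3) that) auto
      also have "\<dots> = (K * \<delta>) * S\<^sup>2" using N_pos unfolding dt by (simp add: K_def field_simps)
      finally show ?thesis using \<delta> by simp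
    qed
    show "\<exists>S\<ge>S1. S > 0 \<and> integral (Q S) (\<lambda>z. \<bar>V 0 z\<bar>) \<le> \<epsilon> * S\<^sup>2"
    proof (cases "c \<ge> N / 2")
      case True
      have "N / 2 * \<bar>N - c\<bar> \<le> c * \<bar>N - c\<bar>" using True by (intro mult_right_mono) auto
      also have "\<dots> \<le> \<delta>" using c(1,4) by (simp add: abs_mult)
      finally have nc: "\<bar>N - c\<bar> \<le> 2 * t" unfolding dt using N_pos by simp
      have "(N - c)\<^sup>2 = \<bar>N - c\<bar> * \<bar>N - c\<bar>" by (simp add: power2_eq_square)
      also have "\<dots> \<le> (N + B) * (2 * t)" using nc c N_pos B by (intro mult_mono) auto
      also have "\<dots> \<le> 4 * ((N + B) * t)" using N_pos B t by (simp add: algebra_simps)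
      finally have "integral (Q S) (\<lambda>z. \<bar>V 0 z\<bar>) \<le> m * S\<^sup>2"
        by (intro key) (simp add: mult_ac)
      also have "\<dots> \<le> \<epsilon> * S\<^sup>2" by (intro mult_right_mono) (auto simp: m_def)
      finally show ?thesis using S by blast
    next
      case False
      have "c * (N / 2) \<le> c * (N - c)" using False c by (intro mult_left_mono) auto
      also have "\<dots> \<le> \<delta>" using c(4) by linarith
      finally have nc: "c \<le> 2 * t" unfolding dt using N_pos by simp
      have "(N - c)\<^sup>2 / 4 - N\<^sup>2 / 4 = - (c * (2 * N - c) / 4)"
        by (simp add: power2_eq_square field_simps)
      moreover have "0 \<le> c * (2 * N - c) / 4" using c False N_pos by simp
      ultimately have "\<bar>(N - c)\<^sup>2 / 4 - N\<^sup>2 / 4\<bar> = c * (2 * N - c) / 4" by linarith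
      also have "\<dots> \<le> (2 * t) * (2 * N + 2 * B) / 4"
        using nc c N_pos B False t by (intro divide_right_mono mult_mono) auto
      finally have "integral (Q S) (\<lambda>z. \<bar>V (N\<^sup>2 / 4) z\<bar>) \<le> m * S\<^sup>2"
        by (intro key) (simp add: algebra_simps)
      also have "\<dots> \<le> \<epsilon>1 * S\<^sup>2" by (intro mult_right_mono) (auto simp: m_def)
      finally show ?thesis using far[of S] S by linarith
    qed
  qed
qed

section \<open>Stress tensor, Pohozaev identity and the Liouville property\<close>

text \<open>The stress tensor has the rows \<open>(stress_d - V \<kappa>, stress_m)\<close> and \<open>(stress_m, - stress_d - V \<kappa>)\<close>.\<close>
definition "stress_d z = (\<Sum>k\<in>I. lam k * ((vx k z)\<^sup>2 - (vy k z)\<^sup>2) / 2)"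
definition "stress_m z = (\<Sum>k\<in>I. lam k * (vx k z * vy k z))"
definition "stress_d_x z = (\<Sum>k\<in>I. lam k * (vx k z * vxx k z - vy k z * vxy k z))"
definition "stress_d_y z = (\<Sum>k\<in>I. lam k * (vx k z * vxy k z - vy k z * vyy k z))"
definition "stress_m_x z = (\<Sum>k\<in>I. lam k * (vxx k z * vy k z + vx k z * vxy k z))"
definition "stress_m_y z = (\<Sum>k\<in>I. lam k * (vxy k z * vy k z + vx k z * vyy k z))"

lemma cont_stress_d: "continuous_on UNIV stress_d" and cont_stress_m: "continuous_on UNIV stress_m"
  and cont_stress_d_x: "continuous_on UNIV stress_d_x" and cont_stress_d_y: "continuous_on UNIV stress_d_y"
  and cont_stress_m_x: "continuous_on UNIV stress_m_x" and cont_stress_m_y: "continuous_on UNIV stress_m_y"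
  unfolding stress_d_def stress_m_def stress_d_x_def stress_d_y_def stress_m_x_def stress_m_y_def
  by (intro continuous_intros cont; simp)+

lemmas stress_conts = cont_stress_d cont_stress_m cont_stress_d_x cont_stress_d_y cont_stress_m_x cont_stress_m_y cont_V

lemma D_stress_d: "((\<lambda>t. stress_d (t, y)) has_real_derivative stress_d_x (x, y)) (at x)"
    "((\<lambda>t. stress_d (x, t)) has_real_derivative stress_d_y (x, y)) (at y)"
  unfolding stress_d_def stress_d_x_def stress_d_y_def
  by (intro DERIV_sum; auto intro!: derivative_eq_intros D_xx D_xy D_yx D_yy simp: field_simps)+

lemma D_stress_m: "((\<lambda>t. stress_m (t, y)) has_real_derivative stress_m_x (x, y)) (at x)"
    "((\<lambda>t. stress_m (x, t)) has_real_derivative stress_m_y (x, y)) (at y)"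
  unfolding stress_m_def stress_m_x_def stress_m_y_def
  by (intro DERIV_sum; auto intro!: derivative_eq_intros D_xx D_xy D_yx D_yy simp: algebra_simps)+

lemma D_V: "((\<lambda>t. V \<kappa> (t, y)) has_real_derivative - ((N - modsq (x, y)) * modsq_x (x, y) / 2)) (at x)"
    "((\<lambda>t. V \<kappa> (x, t)) has_real_derivative - ((N - modsq (x, y)) * modsq_y (x, y) / 2)) (at y)"
  unfolding V_def by (auto intro!: derivative_eq_intros D_modsq simp: field_simps)

text \<open>Multiply the equations by \<open>vx k\<close>, respectively \<open>vy k\<close>, and sum: the result is the derivative of
  the potential on one side and the divergence of the gradient part of the tensor on the other. The
  symmetry of the mixed derivatives is used here.\<close>
lemma stress_divergence_free:
  "stress_d_x z + (N - modsq z) * modsq_x z / 2 + stress_m_y z = 0"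
  "stress_m_x z + (- stress_d_y z + (N - modsq z) * modsq_y z / 2) = 0"
proof -
  have eq: "lam k * (vxx k z + vyy k z) = - (v k z * (N - modsq z))" if "k \<in> I" for k
    using eqn[OF that] by (simp add: modsq_def)
  have "stress_d_x z + stress_m_y z = (\<Sum>k\<in>I. vx k z * (lam k * (vxx k z + vyy k z)))"
    unfolding stress_d_x_def stress_m_y_def sum.distrib[symmetric] by (intro sum.cong) (auto simp: algebra_simps)
  also have "\<dots> = (\<Sum>k\<in>I. - ((N - modsq z) / 2) * (2 * v k z * vx k z))"
    by (intro sum.cong refl) (simp only: eq, simp add: field_simps)
  also have "\<dots> = - ((N - modsq z) * modsq_x z / 2)" unfolding sum_distrib_left[symmetric] modsq_x_def by simp
  finally show "stress_d_x z + (N - modsq z) * modsq_x z / 2 + stress_m_y z = 0" by simp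
  have "stress_m_x z - stress_d_y z = (\<Sum>k\<in>I. vy k z * (lam k * (vxx k z + vyy k z)))"
    unfolding stress_m_x_def stress_d_y_def sum_subtractf[symmetric] by (intro sum.cong) (auto simp: algebra_simps)
  also have "\<dots> = (\<Sum>k\<in>I. - ((N - modsq z) / 2) * (2 * v k z * vy k z))"
    by (intro sum.cong refl) (simp only: eq, simp add: field_simps)
  also have "\<dots> = - ((N - modsq z) * modsq_y z / 2)" unfolding sum_distrib_left[symmetric] modsq_y_def by simp
  finally show "stress_m_x z + (- stress_d_y z + (N - modsq z) * modsq_y z / 2) = 0" by simp
qed

lemma stress_bounds: "\<bar>stress_d z\<bar> \<le> edens z / 2" "\<bar>stress_m z\<bar> \<le> edens z / 2"
proof -
  have "\<bar>lam k * ((vx k z)\<^sup>2 - (vy k z)\<^sup>2) / 2\<bar> \<le> lam k * ((vx k z)\<^sup>2 + (vy k z)\<^sup>2) / 2" if "k \<in> I" for k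
  proof -
    have "\<bar>(vx k z)\<^sup>2 - (vy k z)\<^sup>2\<bar> \<le> (vx k z)\<^sup>2 + (vy k z)\<^sup>2" by (simp add: abs_le_iff)
    with lam_pos[OF that] show ?thesis by (simp add: abs_mult)
  qed
  then have "\<bar>stress_d z\<bar> \<le> (\<Sum>k\<in>I. lam k * ((vx k z)\<^sup>2 + (vy k z)\<^sup>2) / 2)"
    unfolding stress_d_def by (intro order_trans[OF sum_abs] sum_mono)
  then show "\<bar>stress_d z\<bar> \<le> edens z / 2" by (simp add: edens_def sum_divide_distrib)
  have "\<bar>lam k * (vx k z * vy k z)\<bar> \<le> lam k * ((vx k z)\<^sup>2 + (vy k z)\<^sup>2) / 2" if "k \<in> I" for k
  proof -
    have "2 * \<bar>vx k z\<bar> * \<bar>vy k z\<bar> \<le> \<bar>vx k z\<bar>\<^sup>2 + \<bar>vy k z\<bar>\<^sup>2" by (rule sum_squares_bound)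
    then have "\<bar>vx k z * vy k z\<bar> \<le> ((vx k z)\<^sup>2 + (vy k z)\<^sup>2) / 2" by (simp add: abs_mult)
    from mult_left_mono[OF this, of "lam k"] lam_pos[OF that] show ?thesis by (simp add: abs_mult)
  qed
  then have "\<bar>stress_m z\<bar> \<le> (\<Sum>k\<in>I. lam k * ((vx k z)\<^sup>2 + (vy k z)\<^sup>2) / 2)"
    unfolding stress_m_def by (intro order_trans[OF sum_abs] sum_mono)
  then show "\<bar>stress_m z\<bar> \<le> edens z / 2" by (simp add: edens_def sum_divide_distrib)
qed

text \<open>The weak form of the two conservation laws, tested with the vector field \<open>(g, h)\<close>.\<close>
lemma stress_test:
  fixes g gx gy h hx hy :: "real \<times> real \<Rightarrow> real"
  assumes g: "\<And>x y. ((\<lambda>t. g (t, y)) has_real_derivative gx (x, y)) (at x)"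
    "\<And>x y. ((\<lambda>t. g (x, t)) has_real_derivative gy (x, y)) (at y)"
    and h: "\<And>x y. ((\<lambda>t. h (t, y)) has_real_derivative hx (x, y)) (at x)"
    "\<And>x y. ((\<lambda>t. h (x, t)) has_real_derivative hy (x, y)) (at y)"
    and c: "continuous_on UNIV g" "continuous_on UNIV gx" "continuous_on UNIV gy"
      "continuous_on UNIV h" "continuous_on UNIV hx" "continuous_on UNIV hy" and "S > 0"
    and g0: "\<And>y. g (S, y) = 0" "\<And>y. g (-S, y) = 0" "\<And>x. g (x, S) = 0" "\<And>x. g (x, -S) = 0"
    and h0: "\<And>y. h (S, y) = 0" "\<And>y. h (-S, y) = 0" "\<And>x. h (x, S) = 0" "\<And>x. h (x, -S) = 0"
  shows "integral (Q S) (\<lambda>z. stress_d z * (gx z - hy z) + stress_m z * (gy z + hx z) - V \<kappa> z * (gx z + hy z)) = 0"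
proof -
  have "integral (Q S) (\<lambda>z. g z * ((stress_d_x z - - ((N - modsq z) * modsq_x z / 2)) + stress_m_y z) + (gx z * (stress_d z - V \<kappa> z) + gy z * stress_m z)) = 0"
    by (rule weighted_divergence[where A="\<lambda>z. stress_d z - V \<kappa> z" and B=stress_m])
      (intro DERIV_diff D_stress_d D_stress_m D_V g c g0 continuous_intros conts stress_conts \<open>S > 0\<close>; simp)+
  moreover have "(stress_d_x z - - ((N - modsq z) * modsq_x z / 2)) + stress_m_y z = 0" for z
    using stress_divergence_free(1)[of z] by simp
  ultimately have 1: "integral (Q S) (\<lambda>z. gx z * (stress_d z - V \<kappa> z) + gy z * stress_m z) = 0" by simp
  have "integral (Q S) (\<lambda>z. h z * (stress_m_x z + (- stress_d_y z - - ((N - modsq z) * modsq_y z / 2))) + (hx z * stress_m z + hy z * (- stress_d z - V \<kappa> z))) = 0"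
    by (rule weighted_divergence[where A=stress_m and B="\<lambda>z. - stress_d z - V \<kappa> z"])
      (intro DERIV_diff DERIV_minus D_stress_d D_stress_m D_V h c h0 continuous_intros conts stress_conts \<open>S > 0\<close>; simp)+
  moreover have "stress_m_x z + (- stress_d_y z - - ((N - modsq z) * modsq_y z / 2)) = 0" for z
    using stress_divergence_free(2)[of z] by simp
  ultimately have 2: "integral (Q S) (\<lambda>z. hx z * stress_m z + hy z * (- stress_d z - V \<kappa> z)) = 0" by simp
  have i: "(\<lambda>z. gx z * (stress_d z - V \<kappa> z) + gy z * stress_m z) integrable_on Q S"
    "(\<lambda>z. hx z * stress_m z + hy z * (- stress_d z - V \<kappa> z)) integrable_on Q S"
    by (intro integrable_Q continuous_intros c stress_conts)+
  have "integral (Q S) (\<lambda>z. (gx z * (stress_d z - V \<kappa> z) + gy z * stress_m z) + (hx z * stress_m z + hy z * (- stress_d z - V \<kappa> z))) = 0"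
    unfolding integral_add[OF i] 1 2 by simp
  then show ?thesis by (simp add: algebra_simps)
qed

text \<open>Test the stress tensor with the field \<open>cutoff * weight * (x, y)\<close>. The integrand equals
  \<open>- 2 V \<kappa> * cutoff * weight\<^sup>2\<close> up to the pointwise error bounded above.\<close>
lemma pohozaev:
  assumes a: "a > 0" and S: "S > 0"
  shows "\<bar>integral (Q S) (\<lambda>z. V \<kappa> z * (cutoff S z * (weight a z)\<^sup>2))\<bar>
    \<le> integral (Q S) (\<lambda>z. edens z * remainder_weight a z)
      + a\<^sup>2 / S\<^sup>2 * (integral (Q S) edens + integral (Q S) (\<lambda>z. \<bar>V \<kappa> z\<bar>))"
proof -
  define fx where "fx z = - 2 * fst z * (weight a z)\<^sup>2 / a\<^sup>2" for z
  define fy where "fy z = - 2 * snd z * (weight a z)\<^sup>2 / a\<^sup>2" for z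
  define gx where "gx z = cutoff_x S z * weight a z * fst z + cutoff S z * fx z * fst z + cutoff S z * weight a z" for z
  define gy where "gy z = cutoff_y S z * weight a z * fst z + cutoff S z * fy z * fst z" for z
  define hx where "hx z = cutoff_x S z * weight a z * snd z + cutoff S z * fx z * snd z" for z
  define hy where "hy z = cutoff_y S z * weight a z * snd z + cutoff S z * fy z * snd z + cutoff S z * weight a z" for z
  note c = cutoff_cont weight_cont[OF a]
  have cf: "continuous_on UNIV fx" "continuous_on UNIV fy"
    using a unfolding fx_def fy_def by (intro continuous_intros c; simp)+
  have cg: "continuous_on UNIV gx" "continuous_on UNIV gy" "continuous_on UNIV hx" "continuous_on UNIV hy"
    unfolding gx_def gy_def hx_def hy_def by (intro continuous_intros c cf)+
  have wd: "((\<lambda>t. weight a (t, y)) has_real_derivative fx (x, y)) (at x)"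
    "((\<lambda>t. weight a (x, t)) has_real_derivative fy (x, y)) (at y)" for x y
    using weight_deriv[OF a] by (simp_all add: fx_def fy_def)
  define T where "T z = stress_d z * (gx z - hy z) + stress_m z * (gy z + hx z) - V \<kappa> z * (gx z + hy z)" for z
  have T0: "integral (Q S) T = 0"
    unfolding T_def
  proof (rule stress_test[where g="\<lambda>z. cutoff S z * weight a z * fst z" and h="\<lambda>z. cutoff S z * weight a z * snd z"])
    fix x y
    show "((\<lambda>t. cutoff S (t, y) * weight a (t, y) * fst (t, y)) has_real_derivative gx (x, y)) (at x)"
      "((\<lambda>t. cutoff S (x, t) * weight a (x, t) * fst (x, t)) has_real_derivative gy (x, y)) (at y)"
      "((\<lambda>t. cutoff S (t, y) * weight a (t, y) * snd (t, y)) has_real_derivative hx (x, y)) (at x)"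
      "((\<lambda>t. cutoff S (x, t) * weight a (x, t) * snd (x, t)) has_real_derivative hy (x, y)) (at y)"
      unfolding gx_def gy_def hx_def hy_def
      by (auto intro!: derivative_eq_intros cutoff_deriv wd simp: algebra_simps)
  qed (use S in \<open>auto intro!: continuous_intros c cg simp: cutoff_boundary\<close>)
  define P where "P z = V \<kappa> z * (cutoff S z * (weight a z)\<^sup>2)" for z
  define U where "U z = 2 * (edens z * remainder_weight a z) + 2 * (a\<^sup>2 / S\<^sup>2 * (edens z + \<bar>V \<kappa> z\<bar>))" for z
  have cT: "continuous_on UNIV T" unfolding T_def by (intro continuous_intros cg stress_conts)
  have cP: "continuous_on UNIV P" unfolding P_def by (intro continuous_intros c stress_conts)
  have cU: "continuous_on UNIV U"
    unfolding U_def by (intro continuous_intros c stress_conts conts remainder_weight_cont a)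
  have cTP: "continuous_on UNIV (\<lambda>z. T z + 2 * P z)" by (intro continuous_intros cT cP)
  have "\<bar>T z + 2 * P z\<bar> \<le> U z" if "z \<in> Q S" for z
    unfolding T_def P_def U_def gx_def gy_def hx_def hy_def fx_def fy_def remainder_weight_def
    by (rule pohozaev_pointwise; intro stress_bounds cutoff_bounds[OF that S] weight_pos weight_le1 weight_mult_r2 a S)
  then have "\<bar>integral (Q S) (\<lambda>z. T z + 2 * P z)\<bar> \<le> integral (Q S) U"
    using integral_norm_bound_integral[OF integrable_Q[OF cTP] integrable_Q[OF cU]] by simp
  also have "integral (Q S) (\<lambda>z. T z + 2 * P z) = 2 * integral (Q S) P"
    using T0 by (subst integral_add) (auto intro!: integrable_Q cT cP continuous_intros)
  also have "integral (Q S) U = 2 * integral (Q S) (\<lambda>z. edens z * remainder_weight a z)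
      + 2 * (a\<^sup>2 / S\<^sup>2 * integral (Q S) (\<lambda>z. edens z + \<bar>V \<kappa> z\<bar>))"
    unfolding U_def
    by (subst integral_add, (intro integrable_Q continuous_intros conts stress_conts remainder_weight_cont a)+)
      (simp only: integral_mult_right)
  also have "integral (Q S) (\<lambda>z. edens z + \<bar>V \<kappa> z\<bar>) = integral (Q S) edens + integral (Q S) (\<lambda>z. \<bar>V \<kappa> z\<bar>)"
    by (intro integral_add integrable_Q continuous_intros conts stress_conts)
  finally show ?thesis by (simp add: P_def abs_mult)
qed

text \<open>Fix \<open>a\<close> first, large enough for the gradient term; then the square can be chosen so large that
  the two error terms with the factor \<open>a\<^sup>2 / S\<^sup>2\<close> are small as well.\<close>
lemma potential_integral_small:
  assumes "potential_decays \<kappa>" "\<epsilon> > 0"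
  shows "\<exists>a0>0. \<forall>a\<ge>a0. \<forall>S1. \<exists>S\<ge>S1. S > 0 \<and>
    \<bar>integral (Q S) (\<lambda>z. V \<kappa> z * (cutoff S z * (weight a z)\<^sup>2))\<bar> \<le> \<epsilon>"
proof -
  obtain E where E: "E \<ge> 0" "\<And>S. S > 0 \<Longrightarrow> integral (Q S) edens \<le> E" using energy_bound by blast
  obtain a0 where a0: "a0 > 0"
    "\<And>a S. a \<ge> a0 \<Longrightarrow> S > 0 \<Longrightarrow> integral (Q S) (\<lambda>z. edens z * remainder_weight a z) \<le> \<epsilon> / 3"
    using remainder_integral_small[of "\<epsilon> / 3"] \<open>\<epsilon> > 0\<close> by auto
  have "\<exists>S\<ge>S1. S > 0 \<and> \<bar>integral (Q S) (\<lambda>z. V \<kappa> z * (cutoff S z * (weight a z)\<^sup>2))\<bar> \<le> \<epsilon>"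
    if "a \<ge> a0" for a S1
  proof -
    have a: "a > 0" using that a0 by simp
    define R where "R = max (max S1 1) (3 * a\<^sup>2 * E / \<epsilon>)"
    have "\<epsilon> / (3 * a\<^sup>2) > 0" using a \<open>\<epsilon> > 0\<close> by simp
    then obtain S where S: "S \<ge> R" "S > 0" "integral (Q S) (\<lambda>z. \<bar>V \<kappa> z\<bar>) \<le> \<epsilon> / (3 * a\<^sup>2) * S\<^sup>2"
      using assms(1) unfolding potential_decays_def by blast
    have SR: "S \<ge> S1" "S \<ge> 1" "S \<ge> 3 * a\<^sup>2 * E / \<epsilon>" using S(1) by (auto simp: R_def)
    have "3 * a\<^sup>2 * E \<le> \<epsilon> * S" using SR(3) \<open>\<epsilon> > 0\<close> by (simp add: field_simps)
    also have "\<dots> \<le> \<epsilon> * S\<^sup>2" using SR(2) \<open>\<epsilon> > 0\<close> by (simp add: power2_eq_square)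
    finally have 1: "a\<^sup>2 / S\<^sup>2 * E \<le> \<epsilon> / 3" using S by (simp add: field_simps)
    have 2: "a\<^sup>2 / S\<^sup>2 * (\<epsilon> / (3 * a\<^sup>2) * S\<^sup>2) = \<epsilon> / 3" using a S by simp
    have "a\<^sup>2 / S\<^sup>2 * (integral (Q S) edens + integral (Q S) (\<lambda>z. \<bar>V \<kappa> z\<bar>))
        \<le> a\<^sup>2 / S\<^sup>2 * (E + \<epsilon> / (3 * a\<^sup>2) * S\<^sup>2)"
      by (intro mult_left_mono add_mono E S) auto
    also have "\<dots> \<le> \<epsilon> / 3 + \<epsilon> / 3" using 1 2 by (simp only: distrib_left)
    finally show ?thesis
      using pohozaev[OF a S(2), of \<kappa>] a0(2)[OF that S(2)] S SR by (intro exI[of _ S]) linarith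
  qed
  with a0(1) show ?thesis by blast
qed

lemma constant_modulus:
  assumes "potential_decays 0"
  shows "modsq z = N"
proof -
  have "V 0 z = 0" for z
  proof (rule vanishes_of_weighted_integral[OF cont_V])
    show "V 0 z \<ge> 0" for z by (simp add: V_def)
    fix \<epsilon> L :: real assume \<epsilon>: "\<epsilon> > 0"
    obtain a0 where a0: "\<And>a S1. a \<ge> a0 \<Longrightarrow> \<exists>S\<ge>S1. S > 0 \<and>
        \<bar>integral (Q S) (\<lambda>z. V 0 z * (cutoff S z * (weight a z)\<^sup>2))\<bar> \<le> \<epsilon>"
      using potential_integral_small[OF assms \<epsilon>] by blast
    obtain S where "S \<ge> L" "\<bar>integral (Q S) (\<lambda>z. V 0 z * (cutoff S z * (weight (max a0 L) z)\<^sup>2))\<bar> \<le> \<epsilon>"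
      using a0[of "max a0 L" L] by auto
    then show "\<exists>a\<ge>L. \<exists>S\<ge>L. integral (Q S) (\<lambda>z. V 0 z * (cutoff S z * (weight a z)\<^sup>2)) \<le> \<epsilon>"
      by (intro exI[of _ "max a0 L"] conjI exI[of _ S]) auto
  qed
  then show ?thesis by (simp add: V_def)
qed

text \<open>Constant modulus makes each component harmonic, and then the Laplacian of the modulus squared,
  which is zero, equals twice the sum of the squared gradients.\<close>
lemma gradient_vanishes:
  assumes modsq: "\<And>z. modsq z = N" and k: "k \<in> I"
  shows "vx k z = 0" "vy k z = 0"
proof -
  obtain x y where z: "z = (x, y)" by (cases z)
  have modsq_x: "modsq_x (t, y) = 0" and modsq_y: "modsq_y (x, t) = 0" for t x y
    using DERIV_unique[OF D_modsq(1)[of y t]] DERIV_unique[OF D_modsq(2)[of x t]] unfolding modsq by auto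
  have "((\<lambda>t. modsq_x (t, y)) has_real_derivative (\<Sum>k\<in>I. 2 * ((vx k z)\<^sup>2 + v k z * vxx k z))) (at x)"
    unfolding modsq_x_def z
    by (intro DERIV_sum; auto intro!: derivative_eq_intros D_x D_xx simp: algebra_simps power2_eq_square)
  then have 1: "(\<Sum>k\<in>I. 2 * ((vx k z)\<^sup>2 + v k z * vxx k z)) = 0"
    unfolding modsq_x using DERIV_unique DERIV_const by blast
  have "((\<lambda>t. modsq_y (x, t)) has_real_derivative (\<Sum>k\<in>I. 2 * ((vy k z)\<^sup>2 + v k z * vyy k z))) (at y)"
    unfolding modsq_y_def z
    by (intro DERIV_sum; auto intro!: derivative_eq_intros D_y D_yy simp: algebra_simps power2_eq_square)
  then have 2: "(\<Sum>k\<in>I. 2 * ((vy k z)\<^sup>2 + v k z * vyy k z)) = 0"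
    unfolding modsq_y using DERIV_unique DERIV_const by blast
  have "vyy k z = - vxx k z" if "k \<in> I" for k
    using eqn[OF that, of z] lam_pos[OF that] modsq[of z] by (simp add: modsq_def)
  then have "(\<Sum>k\<in>I. 2 * ((vx k z)\<^sup>2 + (vy k z)\<^sup>2))
      = (\<Sum>k\<in>I. 2 * ((vx k z)\<^sup>2 + v k z * vxx k z) + 2 * ((vy k z)\<^sup>2 + v k z * vyy k z))"
    by (intro sum.cong) (auto simp: algebra_simps)
  also have "\<dots> = 0" unfolding sum.distrib 1 2 by simp
  finally have "2 * ((vx k z)\<^sup>2 + (vy k z)\<^sup>2) = 0"
    using sum_nonneg_eq_0_iff[OF fin, of "\<lambda>k. 2 * ((vx k z)\<^sup>2 + (vy k z)\<^sup>2)"] k by simp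
  then have "(vx k z)\<^sup>2 + (vy k z)\<^sup>2 = 0" unfolding mult_eq_0_iff by simp
  then show "vx k z = 0" "vy k z = 0" by (simp_all add: sum_power2_eq_zero_iff)
qed

text \<open>Test the divergence identity for the flux with \<open>g = cutoff * weight\<^sup>2\<close>. The gradient of
  \<open>weight\<^sup>2\<close> is at most \<open>2 weight\<^sup>2 / a\<close> in each coordinate, so for large \<open>a\<close> its contribution is
  absorbed by the energy and by half of \<open>N * modsq\<close>. What remains is that the integral of
  \<open>4 * V (N\<^sup>2 / 4) * g + (N / 2) * modsq * g\<close> is at most a small error, and the first term is already known to
  have a small integral.\<close>
lemma zero_modulus:
  assumes "potential_decays (N\<^sup>2 / 4)"
  shows "modsq z = 0"
proof (rule vanishes_of_weighted_integral[OF cont_modsq modsq_nonneg])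
  fix \<epsilon> L :: real assume \<epsilon>: "\<epsilon> > 0"
  \<comment> \<open>the final estimate reads \<open>(N / 2) * integral \<le> 6 \<eta>\<close>\<close>
  define \<eta> where "\<eta> = N * \<epsilon> / 12"
  have \<eta>: "\<eta> > 0" using N_pos \<epsilon> by (simp add: \<eta>_def)
  obtain a0 where a0: "\<And>a S1. a \<ge> a0 \<Longrightarrow> \<exists>S\<ge>S1. S > 0 \<and>
      \<bar>integral (Q S) (\<lambda>z. V (N\<^sup>2 / 4) z * (cutoff S z * (weight a z)\<^sup>2))\<bar> \<le> \<eta>"
    using potential_integral_small[OF assms \<eta>] by blast
  obtain S0 where S0: "\<And>S. S \<ge> S0 \<Longrightarrow> integral (Q S) (\<lambda>z. \<bar>flux_x z\<bar> + \<bar>flux_y z\<bar>) \<le> \<eta> * S"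
    using flux_integral_small[OF \<eta>] by blast
  define a where "a = max (max a0 L) (max 2 (2 * \<Lambda> / N))"
  have a: "a \<ge> a0" "a \<ge> L" "a \<ge> 2" "a \<ge> 2 * \<Lambda> / N" "a > 0" by (auto simp: a_def)
  obtain S where S: "S \<ge> max S0 L" "S > 0"
    and Vsmall: "\<bar>integral (Q S) (\<lambda>z. V (N\<^sup>2 / 4) z * (cutoff S z * (weight a z)\<^sup>2))\<bar> \<le> \<eta>"
    using a0[OF a(1)] by blast
  define g where "g z = cutoff S z * (weight a z)\<^sup>2" for z
  define gx where "gx z = cutoff_x S z * (weight a z)\<^sup>2 - cutoff S z * (4 * fst z * (weight a z) ^ 3 / a\<^sup>2)" for z
  define gy where "gy z = cutoff_y S z * (weight a z)\<^sup>2 - cutoff S z * (4 * snd z * (weight a z) ^ 3 / a\<^sup>2)" for z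
  note c = cutoff_cont weight_cont[OF a(5)]
  have cg: "continuous_on UNIV g" "continuous_on UNIV gx" "continuous_on UNIV gy"
    using a unfolding g_def gx_def gy_def by (intro continuous_intros c; simp)+
  have g0: "g (S, y) = 0" "g (-S, y) = 0" "g (x, S) = 0" "g (x, -S) = 0" for x y
    using S by (auto simp: g_def cutoff_boundary)
  define T where "T z = g z * (flux_xx z + flux_yy z) + (gx z * flux_x z + gy z * flux_y z)" for z
  have T0: "integral (Q S) T = 0"
    unfolding T_def
  proof (rule weighted_divergence)
    fix x y
    show "((\<lambda>t. g (t, y)) has_real_derivative gx (x, y)) (at x)"
      unfolding g_def gx_def
      by (rule derivative_eq_intros cutoff_deriv weight_deriv a refl)+
        (simp add: power2_eq_square power3_eq_cube)
    show "((\<lambda>t. g (x, t)) has_real_derivative gy (x, y)) (at y)"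
      unfolding g_def gy_def
      by (rule derivative_eq_intros cutoff_deriv weight_deriv a refl)+
        (simp add: power2_eq_square power3_eq_cube)
  qed (intro D_flux conts cg g0 S)+
  define U where "U z = 4 * (V (N\<^sup>2 / 4) z * g z) + (N / 2 * (modsq z * g z) - 2 / S * (\<bar>flux_x z\<bar> + \<bar>flux_y z\<bar>))" for z
  have cT: "continuous_on UNIV T" unfolding T_def by (intro continuous_intros cg conts)
  have cU: "continuous_on UNIV U" unfolding U_def by (intro continuous_intros cg conts cont_V)
  have "U z \<le> T z" if "z \<in> Q S" for z
  proof -
    note b = cutoff_bounds[OF that S(2)]
    have f: "0 < weight a z" "weight a z \<le> 1" "(weight a z)\<^sup>2 \<le> 1"
      using weight_pos[OF a(5)] weight_le1[OF a(5)] by (auto simp: power_le_one less_imp_le)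
    have g0: "g z \<ge> 0" using b by (simp add: g_def)
    have gb: "\<bar>p * (weight a z)\<^sup>2 - cutoff S z * (4 * q * (weight a z) ^ 3 / a\<^sup>2)\<bar> \<le> 2 / S + 2 / a * g z"
      if "\<bar>p\<bar> \<le> 2 / S" "weight a z * \<bar>q\<bar> \<le> a / 2" for p q
    proof -
      have "\<bar>p * (weight a z)\<^sup>2\<bar> \<le> 2 / S * 1" unfolding abs_mult using that f S by (intro mult_mono) auto
      moreover have "\<bar>cutoff S z * (4 * q * (weight a z) ^ 3 / a\<^sup>2)\<bar> = 4 / a\<^sup>2 * g z * (weight a z * \<bar>q\<bar>)"
        using b f by (simp add: abs_mult g_def power2_eq_square power3_eq_cube)
      moreover have "\<dots> \<le> 4 / a\<^sup>2 * g z * (a / 2)" using that g0 by (intro mult_left_mono) auto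
      moreover have "4 / a\<^sup>2 * g z * (a / 2) = 2 / a * g z" using a by (simp add: power2_eq_square)
      ultimately show ?thesis by linarith
    qed
    have "\<bar>gx z * flux_x z + gy z * flux_y z\<bar> \<le> \<bar>gx z\<bar> * \<bar>flux_x z\<bar> + \<bar>gy z\<bar> * \<bar>flux_y z\<bar>"
      by (metis abs_mult abs_triangle_ineq)
    also have "\<dots> \<le> (2 / S + 2 / a * g z) * \<bar>flux_x z\<bar> + (2 / S + 2 / a * g z) * \<bar>flux_y z\<bar>"
      unfolding gx_def gy_def by (intro add_mono mult_right_mono gb b weight_mult_coord a) auto
    also have "\<dots> = 2 / S * (\<bar>flux_x z\<bar> + \<bar>flux_y z\<bar>) + g z * (2 / a * (\<bar>flux_x z\<bar> + \<bar>flux_y z\<bar>))"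
      by (simp add: algebra_simps)
    also have "2 / a * (\<bar>flux_x z\<bar> + \<bar>flux_y z\<bar>) \<le> 2 / a * (edens z + \<Lambda> * modsq z / 2)"
      using flux_young[of 1 z] a by (intro mult_left_mono) auto
    also have "2 / a * (edens z + \<Lambda> * modsq z / 2) = 2 / a * edens z + \<Lambda> / a * modsq z" by (simp add: algebra_simps)
    also have "\<dots> \<le> 1 * edens z + N / 2 * modsq z"
      using a N_pos edens_nonneg[of z] modsq_nonneg[of z] by (intro add_mono mult_right_mono) (auto simp: field_simps)
    finally have *: "\<bar>gx z * flux_x z + gy z * flux_y z\<bar> \<le> 2 / S * (\<bar>flux_x z\<bar> + \<bar>flux_y z\<bar>) + g z * (edens z + N / 2 * modsq z)"
      using g0 by (simp add: mult_left_mono)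
    have "T z = g z * (edens z - modsq z * (N - modsq z)) + (gx z * flux_x z + gy z * flux_y z)" by (simp add: T_def div_flux)
    moreover have "g z * (edens z - modsq z * (N - modsq z)) = 4 * (V (N\<^sup>2 / 4) z * g z) + N / 2 * (modsq z * g z) + g z * (edens z + N / 2 * modsq z)"
      by (simp add: V_def power2_eq_square field_simps)
    ultimately show ?thesis using * unfolding U_def by linarith
  qed
  then have "integral (Q S) U \<le> 0" using integral_Q_mono[OF cU cT, of S] T0 by simp
  also have "integral (Q S) U = 4 * integral (Q S) (\<lambda>z. V (N\<^sup>2 / 4) z * g z)
      + (N / 2 * integral (Q S) (\<lambda>z. modsq z * g z) - 2 / S * integral (Q S) (\<lambda>z. \<bar>flux_x z\<bar> + \<bar>flux_y z\<bar>))"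
    unfolding U_def
    by (subst integral_add, (intro integrable_Q continuous_intros conts cont_V cg)+,
        subst integral_diff, (intro integrable_Q continuous_intros conts cont_V cg)+)
      (simp only: integral_mult_right)
  finally have "N / 2 * integral (Q S) (\<lambda>z. modsq z * g z)
      \<le> 2 / S * integral (Q S) (\<lambda>z. \<bar>flux_x z\<bar> + \<bar>flux_y z\<bar>) + 4 * \<bar>integral (Q S) (\<lambda>z. V (N\<^sup>2 / 4) z * g z)\<bar>"
    by linarith
  also have "\<dots> \<le> 2 / S * (\<eta> * S) + 4 * \<eta>"
    using S Vsmall by (intro add_mono mult_left_mono S0) (auto simp: g_def)
  also have "\<dots> = 6 * \<eta>" using S by simp
  finally have "N / 2 * integral (Q S) (\<lambda>z. modsq z * g z) \<le> 6 * \<eta>" .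
  then have "integral (Q S) (\<lambda>z. modsq z * g z) \<le> \<epsilon>" using N_pos by (simp add: \<eta>_def)
  then show "\<exists>a\<ge>L. \<exists>S\<ge>L. integral (Q S) (\<lambda>z. modsq z * (cutoff S z * (weight a z)\<^sup>2)) \<le> \<epsilon>"
    using a(2) S(1) unfolding g_def by (intro exI[of _ a] exI[of _ S] conjI) auto
qed

lemma liouville:
  "(\<forall>k\<in>I. \<forall>z. v k z = 0) \<or>
    (\<forall>z. (\<Sum>k\<in>I. (v k z)\<^sup>2) = N) \<and> (\<forall>k\<in>I. \<forall>z. vx k z = 0 \<and> vy k z = 0)"
  using potential_dichotomy
proof
  assume "potential_decays 0"
  from constant_modulus[OF this] have "modsq z = N" for z .
  with gradient_vanishes show ?thesis by (auto simp: modsq_def)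
next
  assume "potential_decays (N\<^sup>2 / 4)"
  from zero_modulus[OF this] have "(\<Sum>k\<in>I. (v k z)\<^sup>2) = 0" for z by (simp add: modsq_def)
  then have "v k z = 0" if "k \<in> I" for k z
    using sum_nonneg_eq_0_iff[OF fin, of "\<lambda>k. (v k z)\<^sup>2"] that by simp
  then show ?thesis by blast
qed

end

section \<open>From the plane of vectors to pairs of reals\<close>

lemma smooth_differentiable: "smooth f \<Longrightarrow> f differentiable (at x)"
  unfolding smooth_def using C_k.simps(2) by blast

lemma smooth_continuous: "smooth f \<Longrightarrow> continuous_on UNIV f"
  unfolding smooth_def using C_k.simps(1) by blast

lemma smooth_partial: "smooth f \<Longrightarrow> smooth (partial_deriv k f)"
  unfolding smooth_def partial_deriv_def[abs_def] using C_k.simps(2) by blast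

text \<open>Iterated integrals are formulated for pairs, the theorem for vectors; this isometry identifies
  the two.\<close>
definition plane :: "real \<times> real \<Rightarrow> real ^ 2"
  where "plane z = vector [fst z, snd z]"

definition unplane :: "real ^ 2 \<Rightarrow> real \<times> real"
  where "unplane x = (x $ 1, x $ 2)"

lemma plane_nth [simp]: "plane z $ 1 = fst z" "plane z $ 2 = snd z"
  by (simp_all add: plane_def)

lemma plane_unplane [simp]: "plane (unplane x) = x" and unplane_plane [simp]: "unplane (plane z) = z"
  by (simp_all add: unplane_def vec_eq_iff forall_2)

lemma plane_eq: "plane (x, y) = x *\<^sub>R axis 1 1 + y *\<^sub>R axis 2 1"
  by (simp add: vec_eq_iff forall_2 axis_def)

lemma plane_line_deriv:
  "((\<lambda>t. plane (t, y)) has_vector_derivative axis 1 1) (at x)"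
  "((\<lambda>t. plane (x, t)) has_vector_derivative axis 2 1) (at y)"
  unfolding plane_eq by (auto intro!: derivative_eq_intros)

lemma continuous_plane: "continuous_on A plane"
proof -
  have "plane = (\<lambda>z. fst z *\<^sub>R axis 1 1 + snd z *\<^sub>R axis 2 1)"
    using plane_eq by (metis prod.collapse ext)
  show ?thesis by (subst \<open>plane = _\<close>) (intro continuous_intros)
qed

lemma partial_deriv_line:
  assumes "smooth f"
  shows "((\<lambda>t. f (plane (t, y))) has_vector_derivative partial_deriv 1 f (plane (x, y))) (at x)"
    and "((\<lambda>t. f (plane (x, t))) has_vector_derivative partial_deriv 2 f (plane (x, y))) (at y)"
proof -
  have d: "(f has_derivative frechet_derivative f (at p)) (at p within S)" for p S
    using smooth_differentiable[OF assms] frechet_derivative_works has_derivative_at_withinI by blast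
  show "((\<lambda>t. f (plane (t, y))) has_vector_derivative partial_deriv 1 f (plane (x, y))) (at x)"
    using vector_derivative_diff_chain_within[OF plane_line_deriv(1) d]
    by (simp add: o_def partial_deriv_def)
  show "((\<lambda>t. f (plane (x, t))) has_vector_derivative partial_deriv 2 f (plane (x, y))) (at y)"
    using vector_derivative_diff_chain_within[OF plane_line_deriv(2) d]
    by (simp add: o_def partial_deriv_def)
qed

text \<open>Indexing real and imaginary part by a truth value makes the \<open>2n\<close> real components a family over
  \<open>{1..n} \<times> UNIV\<close>.\<close>
definition part :: "bool \<Rightarrow> complex \<Rightarrow> real"
  where "part b = (if b then Re else Im)"

lemma bounded_linear_part: "bounded_linear (part b)"
  by (simp add: part_def bounded_linear_Re bounded_linear_Im)

lemma sum_part_sq: "(\<Sum>b\<in>UNIV. (part b c)\<^sup>2) = (cmod c)\<^sup>2"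
  by (simp add: UNIV_bool part_def cmod_power2)

lemma part_line:
  assumes "smooth f"
  shows "((\<lambda>t. part b (f (plane (t, y)))) has_real_derivative part b (partial_deriv 1 f (plane (x, y)))) (at x)"
    and "((\<lambda>t. part b (f (plane (x, t)))) has_real_derivative part b (partial_deriv 2 f (plane (x, y)))) (at y)"
  unfolding has_real_derivative_iff_has_vector_derivative
  by (intro bounded_linear.has_vector_derivative[OF bounded_linear_part] partial_deriv_line assms)+

lemma part_continuous: "smooth f \<Longrightarrow> continuous_on UNIV (\<lambda>z. part b (f (plane z)))"
  by (intro bounded_linear.continuous_on[OF bounded_linear_part]
      continuous_on_compose2[OF smooth_continuous continuous_plane]) auto

lemma part_partials_commute:
  assumes "smooth f"
  shows "part b (partial_deriv 1 (partial_deriv 2 f) (plane z)) = part b (partial_deriv 2 (partial_deriv 1 f) (plane z))"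
  using fun_cong[OF partials_commute[where F="\<lambda>z. part b (f (plane z))"
      and Fx="\<lambda>z. part b (partial_deriv 1 f (plane z))" and Fy="\<lambda>z. part b (partial_deriv 2 f (plane z))"
      and Fyx="\<lambda>z. part b (partial_deriv 1 (partial_deriv 2 f) (plane z))"
      and Fxy="\<lambda>z. part b (partial_deriv 2 (partial_deriv 1 f) (plane z))"], of z]
  by (simp add: part_line part_continuous smooth_partial assms)

lemma laplacian_2: "laplacian f x = partial_deriv 1 (partial_deriv 1 f) x + partial_deriv 2 (partial_deriv 2 f) x"
  for f :: "real ^ 2 \<Rightarrow> complex"
  by (simp add: laplacian_def UNIV_2)

lemma norm_gradient_sq: "(norm (gradient f x))\<^sup>2 = (norm (partial_deriv 1 f x))\<^sup>2 + (norm (partial_deriv 2 f x))\<^sup>2"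
  for f :: "real ^ 2 \<Rightarrow> complex"
  by (simp add: norm_vec_def L2_set_def gradient_def sum_2)

lemma plane_image_cbox: "plane ` cbox (a, c) (b, d) = cbox (plane (a, c)) (plane (b, d))"
proof (intro set_eqI iffI)
  fix x assume "x \<in> cbox (plane (a, c)) (plane (b, d))"
  then have "unplane x \<in> cbox (a, c) (b, d)" by (auto simp: mem_box_cart forall_2 cbox_Pair_eq unplane_def)
  then show "x \<in> plane ` cbox (a, c) (b, d)" by (metis image_eqI plane_unplane)
qed (auto simp: mem_box_cart forall_2 cbox_Pair_eq)

lemma unplane_image_cbox: "unplane ` cbox u v = cbox (unplane u) (unplane v)"
proof -
  have "cbox u v = plane ` cbox (unplane u) (unplane v)"
    using plane_image_cbox[of "u $ 1" "u $ 2" "v $ 1" "v $ 2"] by (simp flip: unplane_def)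
  then show ?thesis by (simp add: image_image)
qed

lemma content_plane_image: "measure lborel (plane ` cbox u v) = measure lborel (cbox u v)"
proof -
  obtain a c b d where uv: "u = (a, c)" "v = (b, d)" by (metis surj_pair)
  have "measure lborel (cbox (plane (a, c)) (plane (b, d))) = measure lborel (cbox a b) * measure lborel (cbox c d)"
  proof (cases "a \<le> b \<and> c \<le> d")
    case True
    then have "cbox (plane (a, c)) (plane (b, d)) \<noteq> {}" by (simp add: interval_ne_empty_cart forall_2)
    with True show ?thesis by (simp add: content_cbox_cart UNIV_2)
  next
    case False
    then have "cbox (plane (a, c)) (plane (b, d)) = {}"
      by (auto simp: set_eq_iff mem_box_cart forall_2)
    moreover have "cbox a b = {} \<or> cbox c d = {}" using False by auto
    ultimately show ?thesis by auto
  qed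
  then show ?thesis by (simp add: uv plane_image_cbox content_Pair)
qed

text \<open>The identification maps boxes to boxes of the same measure, so it preserves integrals.\<close>
lemma has_integral_plane:
  fixes f :: "real ^ 2 \<Rightarrow> real"
  assumes "(f has_integral i) (cbox (plane u) (plane v))"
  shows "((\<lambda>z. f (plane z)) has_integral i) (cbox u v)"
proof -
  have "((\<lambda>z. f (plane z)) has_integral (1 / 1) *\<^sub>R i) (unplane ` cbox (plane u) (plane v))"
  proof (rule has_integral_twiddle)
    show "continuous (at x) plane" for x
      using continuous_plane[of UNIV] by (simp add: continuous_on_eq_continuous_at del: split_paired_All)
    show "\<exists>w z. plane ` cbox u v = cbox w z" for u v
      using plane_image_cbox by (metis surj_pair)
    show "\<exists>w z. unplane ` cbox u v = cbox w z" for u v using unplane_image_cbox by blast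
  qed (use assms content_plane_image in auto)
  then show ?thesis by (simp add: unplane_image_cbox)
qed

lemma square_integral_bound:
  fixes G :: "real ^ 2 \<Rightarrow> real"
  assumes cont: "continuous_on UNIV G" and nonneg: "\<And>x. G x \<ge> 0"
    and fin: "(\<integral>\<^sup>+ x. ennreal (G x) \<partial>lborel) < \<infinity>"
  shows "integral (Q S) (\<lambda>z. G (plane z)) \<le> integral UNIV G"
proof -
  have "integrable lborel G"
    using fin nonneg cont by (intro integrableI_nonneg) (auto intro: borel_measurable_continuous_onI)
  then have int: "G integrable_on UNIV"
    using integrable_on_lborel by blast
  have "G integrable_on cbox (plane (-S, -S)) (plane (S, S))"
    using cont by (intro integrable_continuous) (auto intro: continuous_on_subset)
  from has_integral_plane[OF integrable_integral[OF this]]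
  have "integral (Q S) (\<lambda>z. G (plane z)) = integral (cbox (plane (-S, -S)) (plane (S, S))) G"
    unfolding Q_def by (rule integral_unique)
  also have "\<dots> \<le> integral UNIV G"
    by (rule integral_subset_le) (use int nonneg \<open>G integrable_on cbox _ _\<close> in auto)
  finally show ?thesis .
qed

theorem theorem1p1:
  fixes n :: nat
    and lam :: "nat \<Rightarrow> real"
    and u :: "nat \<Rightarrow> real ^ 2 \<Rightarrow> complex"
  assumes n_pos: "n > 0"
    and lam_pos: "\<And>i. i \<in> {1..n} \<Longrightarrow> lam i > 0"
    and smooth_u: "\<And>i. i \<in> {1..n} \<Longrightarrow> smooth (u i)"
    and equation: "\<And>i x. i \<in> {1..n} \<Longrightarrow>
      - (complex_of_real (lam i) * laplacian (u i) x) =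
        u i x * complex_of_real (real n - (\<Sum>j=1..n. (cmod (u j x))\<^sup>2))"
    and finite_energy:
      "(\<Sum>j=1..n. \<integral>\<^sup>+ x. ennreal ((norm (gradient (u j) x))\<^sup>2) \<partial>lborel) < \<infinity>"
  shows "(\<forall>i\<in>{1..n}. \<forall>x. u i x = 0) \<or>
    (\<exists>c :: nat \<Rightarrow> complex. (\<forall>i\<in>{1..n}. \<forall>x. u i x = c i) \<and>
      (\<Sum>i=1..n. (cmod (c i))\<^sup>2) = real n)"
proof -
  define I :: "(nat \<times> bool) set" where "I = {1..n} \<times> UNIV"
  define l where "l k = lam (fst k)" for k :: "nat \<times> bool"
  define comp where "comp F k z = part (snd k) (F (u (fst k)) (plane z))"
    for F :: "(real ^ 2 \<Rightarrow> complex) \<Rightarrow> real ^ 2 \<Rightarrow> complex" and k :: "nat \<times> bool" and z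
  define D1 :: "(real ^ 2 \<Rightarrow> complex) \<Rightarrow> real ^ 2 \<Rightarrow> complex" where "D1 = partial_deriv 1"
  define D2 :: "(real ^ 2 \<Rightarrow> complex) \<Rightarrow> real ^ 2 \<Rightarrow> complex" where "D2 = partial_deriv 2"
  have sm: "smooth (u (fst k))" if "k \<in> I" for k using smooth_u that by (auto simp: I_def)
  have sums: "(\<Sum>k\<in>I. \<phi> (fst k) (snd k)) = (\<Sum>i=1..n. \<Sum>b\<in>UNIV. \<phi> i b)" for \<phi> :: "nat \<Rightarrow> bool \<Rightarrow> real"
    unfolding I_def sum.cartesian_product by (simp add: case_prod_unfold)
  have modulus: "(\<Sum>k\<in>I. (comp id k z)\<^sup>2) = (\<Sum>i=1..n. (cmod (u i (plane z)))\<^sup>2)" for z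
    unfolding comp_def using sums[of "\<lambda>i b. (part b (u i (plane z)))\<^sup>2"] by (simp add: sum_part_sq)
  define G where "G x = (\<Sum>i=1..n. lam i * (norm (gradient (u i) x))\<^sup>2)" for x
  have energy: "(\<Sum>k\<in>I. l k * ((comp D1 k z)\<^sup>2 + (comp D2 k z)\<^sup>2)) = G (plane z)" for z
    using sums[of "\<lambda>i b. lam i * ((part b (D1 (u i) (plane z)))\<^sup>2 + (part b (D2 (u i) (plane z)))\<^sup>2)"]
    by (simp add: comp_def l_def G_def norm_gradient_sq D1_def D2_def sum.distrib sum_part_sq
        flip: sum_distrib_left)
  have cgrad: "continuous_on UNIV (\<lambda>x. (norm (gradient (u i) x))\<^sup>2)" if "i \<in> {1..n}" for i
    unfolding norm_gradient_sq
    by (intro continuous_intros smooth_continuous smooth_partial smooth_u that)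
  have cG: "continuous_on UNIV G"
    unfolding G_def by (intro continuous_intros cgrad)
  have nG: "G x \<ge> 0" for x
    unfolding G_def using lam_pos by (intro sum_nonneg mult_nonneg_nonneg) (simp_all add: less_imp_le)
  have G_ennreal: "ennreal (G x) = (\<Sum>i=1..n. ennreal (lam i) * ennreal ((norm (gradient (u i) x))\<^sup>2))" for x
  proof -
    have "ennreal (G x) = (\<Sum>i=1..n. ennreal (lam i * (norm (gradient (u i) x))\<^sup>2))"
      unfolding G_def using lam_pos
      by (intro sum_ennreal[symmetric] mult_nonneg_nonneg) (simp_all add: less_imp_le)
    also have "\<dots> = (\<Sum>i=1..n. ennreal (lam i) * ennreal ((norm (gradient (u i) x))\<^sup>2))"
      using lam_pos by (intro sum.cong refl ennreal_mult) (simp_all add: less_imp_le)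
    finally show ?thesis .
  qed
  have [measurable]: "(\<lambda>x. (norm (gradient (u i) x))\<^sup>2) \<in> borel_measurable borel" if "Suc 0 \<le> i" "i \<le> n" for i
    by (rule borel_measurable_continuous_onI[OF cgrad]) (use that in simp)
  have "(\<integral>\<^sup>+ x. ennreal (G x) \<partial>lborel)
      = (\<integral>\<^sup>+ x. (\<Sum>i=1..n. ennreal (lam i) * ennreal ((norm (gradient (u i) x))\<^sup>2)) \<partial>lborel)"
    unfolding G_ennreal ..
  also have "\<dots> = (\<Sum>i=1..n. ennreal (lam i) * (\<integral>\<^sup>+ x. ennreal ((norm (gradient (u i) x))\<^sup>2) \<partial>lborel))"
    by (subst nn_integral_sum) (auto intro!: sum.cong nn_integral_cmult)
  also have "\<dots> < \<infinity>"
    using finite_energy by (auto simp: ennreal_mult_less_top less_top)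
  finally have fG: "(\<integral>\<^sup>+ x. ennreal (G x) \<partial>lborel) < \<infinity>" .
  \<comment> \<open>The real and imaginary parts solve a system of the same shape, in which the coefficient of a part
     is that of its component.\<close>
  interpret gl_system I l "real n" "comp id" "comp D1" "comp D2"
    "comp (\<lambda>f. D1 (D1 f))" "comp (\<lambda>f. D2 (D1 f))" "comp (\<lambda>f. D2 (D2 f))"
  proof
    show "finite I" by (simp add: I_def)
    show "real n > 0" using n_pos by simp
    show "\<exists>E. \<forall>S>0. integral (Q S) (\<lambda>z. \<Sum>k\<in>I. l k * ((comp D1 k z)\<^sup>2 + (comp D2 k z)\<^sup>2)) \<le> E"
      unfolding energy using square_integral_bound[OF cG nG fG] by blast
  next
    fix k z assume k: "k \<in> I"
    then show "l k > 0" using lam_pos by (auto simp: I_def l_def)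
    obtain i b where ib: "k = (i, b)" "i \<in> {1..n}" using k by (auto simp: I_def)
    define h where "h = real n - (\<Sum>j=1..n. (cmod (u j (plane z)))\<^sup>2)"
    have "part b (- (complex_of_real (lam i) * laplacian (u i) (plane z))) = part b (u i (plane z) * complex_of_real h)"
      using equation[OF ib(2), of "plane z"] by (simp add: h_def)
    then show "l k * (comp (\<lambda>f. D1 (D1 f)) k z + comp (\<lambda>f. D2 (D2 f)) k z)
        = - (comp id k z * (real n - (\<Sum>j\<in>I. (comp id j z)\<^sup>2)))"
      unfolding modulus h_def[symmetric]
      by (auto simp: ib l_def comp_def D1_def D2_def laplacian_2 part_def algebra_simps)
  next
    fix k and x y :: real assume k: "k \<in> I"
    note s = sm[OF k]
    show "((\<lambda>t. comp id k (t, y)) has_real_derivative comp D1 k (x, y)) (at x)"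
      "((\<lambda>t. comp id k (x, t)) has_real_derivative comp D2 k (x, y)) (at y)"
      "((\<lambda>t. comp D1 k (t, y)) has_real_derivative comp (\<lambda>f. D1 (D1 f)) k (x, y)) (at x)"
      "((\<lambda>t. comp D1 k (x, t)) has_real_derivative comp (\<lambda>f. D2 (D1 f)) k (x, y)) (at y)"
      "((\<lambda>t. comp D2 k (x, t)) has_real_derivative comp (\<lambda>f. D2 (D2 f)) k (x, y)) (at y)"
      unfolding comp_def id_def D1_def D2_def by (intro part_line smooth_partial s)+
    show "((\<lambda>t. comp D2 k (t, y)) has_real_derivative comp (\<lambda>f. D2 (D1 f)) k (x, y)) (at x)"
      unfolding comp_def D1_def D2_def part_partials_commute[OF s, symmetric]
      by (intro part_line smooth_partial s)
  next
    fix k assume k: "k \<in> I"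
    note s = sm[OF k]
    show "continuous_on UNIV (comp id k)" "continuous_on UNIV (comp D1 k)" "continuous_on UNIV (comp D2 k)"
      "continuous_on UNIV (comp (\<lambda>f. D1 (D1 f)) k)" "continuous_on UNIV (comp (\<lambda>f. D2 (D1 f)) k)"
      "continuous_on UNIV (comp (\<lambda>f. D2 (D2 f)) k)"
      unfolding comp_def[abs_def] id_def D1_def D2_def by (intro part_continuous smooth_partial s)+
  qed
  have eqI: "u i (plane z) = w" if "\<And>b. part b (u i (plane z)) = part b w" for i z w
    using that[of True] that[of False] by (auto simp: part_def complex_eq_iff)
  show ?thesis
    using liouville
  proof
    assume zero: "\<forall>k\<in>I. \<forall>z. comp id k z = 0"
    have "u i x = 0" if "i \<in> {1..n}" for i x
    proof -
      have "part b (u i (plane (unplane x))) = part b 0" for b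
        using zero[rule_format, of "(i, b)" "unplane x"] that by (simp add: comp_def I_def) (simp add: part_def)
      then have "u i (plane (unplane x)) = 0" by (rule eqI)
      then show ?thesis by simp
    qed
    then show ?thesis by blast
  next
    assume const: "(\<forall>z. (\<Sum>k\<in>I. (comp id k z)\<^sup>2) = real n) \<and> (\<forall>k\<in>I. \<forall>z. comp D1 k z = 0 \<and> comp D2 k z = 0)"
    have cst: "comp id k (x, y) = comp id k (0, 0)" if k: "k \<in> I" for k x y
    proof -
      have "comp id k (x, y) = comp id k (0, y)"
        by (rule DERIV_isconst_all[of "\<lambda>t. comp id k (t, y)"]) (use D_x[OF k] const k in metis)
      also have "\<dots> = comp id k (0, 0)"
        by (rule DERIV_isconst_all[of "\<lambda>t. comp id k (0, t)"]) (use D_y[OF k] const k in metis)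
      finally show ?thesis .
    qed
    have "u i x = u i (plane (0, 0))" if "i \<in> {1..n}" for i x
    proof -
      have "part b (u i (plane (unplane x))) = part b (u i (plane (0, 0)))" for b
        using cst[of "(i, b)" "fst (unplane x)" "snd (unplane x)"] that by (simp add: comp_def I_def)
      then have "u i (plane (unplane x)) = u i (plane (0, 0))" by (rule eqI)
      then show ?thesis by simp
    qed
    moreover have "(\<Sum>i=1..n. (cmod (u i (plane (0, 0))))\<^sup>2) = real n"
      using const modulus[of "(0, 0)"] by simp
    ultimately show ?thesis by (intro disjI2 exI[of _ "\<lambda>i. u i (plane (0, 0))"]) blast
  qed
qed

end
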